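(* Let $\mathcal{L}=(L_1,L_2,P,\&_1,\swarrow^1,\nwarrow_1,\dots,\&_n,\swarrow^n,\nwarrow_n)$ be a multi-adjoint object-oriented frame and $(X,Y,\phi)$ a context of $\mathcal{L}$, i.e. sets $X$ (properties), $Y$ (objects), a map $\phi:X\times Y\to P$ and a map $|\cdot|:Y\to\{1,\dots,n\}$. Let $\phi_O:X\to\!\!\!\!\circ\; Y$ be the $\mathcal{Q}_O^{\mathcal{L}}$-relation with $|x|=0$ for $x\in X$, the given types for $y\in Y$, and $\phi_O(x,y)=\phi(x,y)\in\mathcal{Q}_O^{\mathcal{L}}(0,|y|)=P$. Then the multi-adjoint object-oriented concept lattice of $(X,Y,\phi)$ is isomorphic, as a complete lattice, to the $(-1)$-fibre $(\mathcal{K}^\dagger\phi_O)_{-1}$ of the complete $\mathcal{Q}_O^{\mathcal{L}}$-category $\mathcal{K}^\dagger\phi_O$ of fixed points of the dual Kan adjunction induced by $\phi_O$.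
   Context: Multi-adjoint object-oriented frame: complete lattices $L_1,L_2,P$ and for $i=1,\dots,n$ maps $\&_i:L_1\times P\to L_2$, $\swarrow^i:L_2\times P\to L_1$, $\nwarrow_i:L_2\times L_1\to P$ with $x\,\&_i\,z\le y\iff x\le y\swarrow^i z\iff z\le y\nwarrow_i x$. Quantaloid $\mathcal{Q}_O^{\mathcal{L}}$: objects $-1,0,1,\dots,n$; $\mathcal{Q}_O^{\mathcal{L}}(-1,0)=L_1$, $\mathcal{Q}_O^{\mathcal{L}}(0,i)=P$, $\mathcal{Q}_O^{\mathcal{L}}(-1,i)=L_2$ ($1\le i\le n$); $\mathcal{Q}_O^{\mathcal{L}}(i,i)=\{\bot_{i,i}<\mathrm{id}_i\}$; all other hom-sets one-element; composition $v\circ u=u\,\&_i\,v$ for $u\in L_1=\mathcal{Q}_O^{\mathcal{L}}(-1,0)$, $v\in P=\mathcal{Q}_O^{\mathcal{L}}(0,i)$, identities act as identities, other composites are bottom. Its right implication (defined by $v\circ u\le w\iff u\le v\backslash w$) satisfies $v\backslash w=w\swarrow^i v$ for $v\in P$, $w\in L_2$. For a quantaloid $\mathcal{Q}$ and object-typed sets $X,Y$, a $\mathcal{Q}$-relation $\phi$ assigns $\phi(x,y)\in\mathcal{Q}(|x|,|y|)$. Regarding $X,Y$ as discrete $\mathcal{Q}$-categories, a copresheaf of type $q$ on $Y$ is a map $\lambda$ with $\lambda(y)\in\mathcal{Q}(q,|y|)$; the copresheaf $\mathcal{Q}$-category $\mathcal{P}^\dagger Y$ has hom $\bigwedge_y\lambda'(y)\backslash\lambda(y)$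 and its underlying order on copresheaves of a fixed type is the reverse of the pointwise order. The dual Kan adjunction $\phi_\dagger\dashv\phi^\dagger:\mathcal{P}^\dagger Y\to\mathcal{P}^\dagger X$ is given by $(\phi_\dagger\lambda)(x)=\bigwedge_{y\in Y}\phi(x,y)\backslash\lambda(y)$ and $(\phi^\dagger\mu)(y)=\bigvee_{x\in X}\phi(x,y)\circ\mu(x)$. $\mathcal{K}^\dagger\phi=\{\lambda\in\mathcal{P}^\dagger Y\mid\phi^\dagger\phi_\dagger\lambda=\lambda\}$ with inherited structure, and $(\mathcal{K}^\dagger\phi)_q$ is its set of elements of type $q$ with the underlying order. Concretely, $(\mathcal{K}^\dagger\phi_O)_{-1}=\{\lambda\in L_2^Y\mid\lambda=\phi^\dagger\phi_\dagger\lambda\}$ ordered by reverse pointwise order, where for $\lambda\in L_2^Y$, $\mu\in L_1^X$: $(\phi_\dagger\lambda)(x)=\bigwedge_{y\in Y}\lambda(y)\swarrow^{|y|}\phi(x,y)$ and $(\phi^\dagger\mu)(y)=\bigvee_{x\in X}\mu(x)\,\&_{|y|}\,\phi(x,y)$. The multi-adjoint object-oriented concept lattice of $(X,Y,\phi)$ is the complete lattice of fixed points of this Galois connection $\phi_\dagger:L_2^Y\rightleftarrows L_1^X:\phi^\dagger$ (taken with the orders of the $(-1)$-fibres, i.e. reverse pointwise), i.e. the set of pairs $(\lambda,\mu)\in L_2^Y\times L_1^X$ with $\phi_\dagger\lambda=\mu$ and $\phi^\dagger\mu=\lambda$, ordered by $(\lambda_1,\mu_1)\le(\lambda_2,\mu_2)$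 iff $\lambda_2\le\lambda_1$ pointwise (equivalently $\mu_2\le\mu_1$ pointwise). *)

theory Defs
  imports "HOL-Algebra.Complete_Lattice"
begin

section \<open>Quantaloids\<close>

text \<open>Hom-sets are indexed by their endpoints, so they need not be disjoint:
  \<open>Comp Q p q r v u\<close> is the composite of \<open>u : p \<rightarrow> q\<close> followed by \<open>v : q \<rightarrow> r\<close>.\<close>

record ('o, 'a) qtld =
  Ob :: "'o set"
  Hom :: "'o \<Rightarrow> 'o \<Rightarrow> 'a gorder"
  Comp :: "'o \<Rightarrow> 'o \<Rightarrow> 'o \<Rightarrow> 'a \<Rightarrow> 'a \<Rightarrow> 'a"
  Ident :: "'o \<Rightarrow> 'a"

abbreviation Arr :: "('o, 'a, 'm) qtld_scheme \<Rightarrow> 'o \<Rightarrow> 'o \<Rightarrow> 'a set" where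
  "Arr Q p q \<equiv> carrier (Hom Q p q)"

locale quantaloid =
  fixes Q :: "('o, 'a, 'm) qtld_scheme"
  assumes Hom_complete: "\<lbrakk>p \<in> Ob Q; q \<in> Ob Q\<rbrakk> \<Longrightarrow> complete_lattice (Hom Q p q)"
    and Ident_closed: "p \<in> Ob Q \<Longrightarrow> Ident Q p \<in> Arr Q p p"
    and Comp_closed: "\<lbrakk>p \<in> Ob Q; q \<in> Ob Q; r \<in> Ob Q; u \<in> Arr Q p q; v \<in> Arr Q q r\<rbrakk>
      \<Longrightarrow> Comp Q p q r v u \<in> Arr Q p r"
    and Comp_assoc: "\<lbrakk>p \<in> Ob Q; q \<in> Ob Q; r \<in> Ob Q; s \<in> Ob Q;
        u \<in> Arr Q p q; v \<in> Arr Q q r; w \<in> Arr Q r s\<rbrakk>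
      \<Longrightarrow> Comp Q p q s (Comp Q q r s w v) u = Comp Q p r s w (Comp Q p q r v u)"
    and Comp_Ident_left: "\<lbrakk>p \<in> Ob Q; q \<in> Ob Q; u \<in> Arr Q p q\<rbrakk>
      \<Longrightarrow> Comp Q p q q (Ident Q q) u = u"
    and Comp_Ident_right: "\<lbrakk>p \<in> Ob Q; q \<in> Ob Q; u \<in> Arr Q p q\<rbrakk>
      \<Longrightarrow> Comp Q p p q u (Ident Q p) = u"
    and Comp_Sup_right: "\<lbrakk>p \<in> Ob Q; q \<in> Ob Q; r \<in> Ob Q; S \<subseteq> Arr Q p q; v \<in> Arr Q q r\<rbrakk>
      \<Longrightarrow> Comp Q p q r v (\<Squnion>\<^bsub>Hom Q p q\<^esub> S) = \<Squnion>\<^bsub>Hom Q p r\<^esub> ((\<lambda>u. Comp Q p q r v u) ` S)"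
    and Comp_Sup_left: "\<lbrakk>p \<in> Ob Q; q \<in> Ob Q; r \<in> Ob Q; u \<in> Arr Q p q; S \<subseteq> Arr Q q r\<rbrakk>
      \<Longrightarrow> Comp Q p q r (\<Squnion>\<^bsub>Hom Q q r\<^esub> S) u = \<Squnion>\<^bsub>Hom Q p r\<^esub> ((\<lambda>v. Comp Q p q r v u) ` S)"

text \<open>For \<open>v : q \<rightarrow> r\<close> and \<open>w : p \<rightarrow> r\<close>, the arrow \<open>v \ w : p \<rightarrow> q\<close>.\<close>

definition rimp :: "('o, 'a, 'm) qtld_scheme \<Rightarrow> 'o \<Rightarrow> 'o \<Rightarrow> 'o \<Rightarrow> 'a \<Rightarrow> 'a \<Rightarrow> 'a" where
  "rimp Q p q r v w = (THE x. x \<in> Arr Q p q \<and>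
     (\<forall>u \<in> Arr Q p q. Comp Q p q r v u \<sqsubseteq>\<^bsub>Hom Q p r\<^esub> w \<longleftrightarrow> u \<sqsubseteq>\<^bsub>Hom Q p q\<^esub> x))"


section \<open>Categories enriched in a quantaloid\<close>

record ('o, 'a, 'x) qcat =
  Obj :: "'x set"
  otype :: "'x \<Rightarrow> 'o"
  qhom :: "'x \<Rightarrow> 'x \<Rightarrow> 'a"

definition qcategory :: "('o, 'a, 'm) qtld_scheme \<Rightarrow> ('o, 'a, 'x) qcat \<Rightarrow> bool" where
  "qcategory Q A \<longleftrightarrow>
     (\<forall>x \<in> Obj A. otype A x \<in> Ob Q) \<and>
     (\<forall>x \<in> Obj A. \<forall>y \<in> Obj A. qhom A x y \<in> Arr Q (otype A x) (otype A y)) \<and>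
     (\<forall>x \<in> Obj A. Ident Q (otype A x) \<sqsubseteq>\<^bsub>Hom Q (otype A x) (otype A x)\<^esub> qhom A x x) \<and>
     (\<forall>x \<in> Obj A. \<forall>y \<in> Obj A. \<forall>z \<in> Obj A.
        Comp Q (otype A x) (otype A y) (otype A z) (qhom A y z) (qhom A x y)
          \<sqsubseteq>\<^bsub>Hom Q (otype A x) (otype A z)\<^esub> qhom A x z)"

text \<open>Completeness: every copresheaf \<open>l\<close> of type \<open>q\<close> has an infimum, that is, the weighted
  limit \<open>a\<close> characterised by \<open>A(z, a) = \<Sqinter>\<^sub>x l(x) \ A(z, x)\<close>.\<close>

definition complete_qcategory :: "('o, 'a, 'm) qtld_scheme \<Rightarrow> ('o, 'a, 'x) qcat \<Rightarrow> bool" where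
  "complete_qcategory Q A \<longleftrightarrow> qcategory Q A \<and>
     (\<forall>q \<in> Ob Q. \<forall>l.
        (\<forall>x \<in> Obj A. l x \<in> Arr Q q (otype A x)) \<and>
        (\<forall>x \<in> Obj A. \<forall>y \<in> Obj A.
           Comp Q q (otype A x) (otype A y) (qhom A x y) (l x) \<sqsubseteq>\<^bsub>Hom Q q (otype A y)\<^esub> l y) \<longrightarrow>
        (\<exists>a \<in> Obj A. otype A a = q \<and>
           (\<forall>z \<in> Obj A. qhom A z a =
              \<Sqinter>\<^bsub>Hom Q (otype A z) q\<^esub> ((\<lambda>x. rimp Q (otype A z) q (otype A x) (l x) (qhom A z x)) ` Obj A))))"

text \<open>The objects of type \<open>q\<close> with the underlying order of the category.\<close>

definition fibre :: "('o, 'a, 'm) qtld_scheme \<Rightarrow> ('o, 'a, 'x) qcat \<Rightarrow> 'o \<Rightarrow> 'x gorder" where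
  "fibre Q A q = \<lparr>carrier = {x \<in> Obj A. otype A x = q}, eq = (=),
     le = (\<lambda>x y. otype A x = otype A y \<and>
        Ident Q (otype A x) \<sqsubseteq>\<^bsub>Hom Q (otype A x) (otype A y)\<^esub> qhom A x y)\<rparr>"

text \<open>Copresheaves on a typed set \<open>(Y, t)\<close>, regarded as a discrete category. A copresheaf carries
  its type as first component; its values outside \<open>Y\<close> are fixed to \<^const>\<open>undefined\<close>.\<close>

definition copresheaves ::
    "('o, 'a, 'm) qtld_scheme \<Rightarrow> 'y set \<Rightarrow> ('y \<Rightarrow> 'o) \<Rightarrow> ('o, 'a, 'o \<times> ('y \<Rightarrow> 'a)) qcat" where
  "copresheaves Q Y t =
     \<lparr>Obj = {(q, l). q \<in> Ob Q \<and> l \<in> (\<Pi>\<^sub>E y \<in> Y. Arr Q q (t y))},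
      otype = fst,
      qhom = (\<lambda>(q, l) (q', l'). \<Sqinter>\<^bsub>Hom Q q q'\<^esub> ((\<lambda>y. rimp Q q q' (t y) (l' y) (l y)) ` Y))\<rparr>"


section \<open>Relations and the dual Kan adjunction\<close>

record ('o, 'a, 'x, 'y) qrel =
  src :: "'x set"
  styp :: "'x \<Rightarrow> 'o"
  tgt :: "'y set"
  ttyp :: "'y \<Rightarrow> 'o"
  rel :: "'x \<Rightarrow> 'y \<Rightarrow> 'a"

definition qrelation :: "('o, 'a, 'm) qtld_scheme \<Rightarrow> ('o, 'a, 'x, 'y) qrel \<Rightarrow> bool" where
  "qrelation Q \<phi> \<longleftrightarrow>
     (\<forall>x \<in> src \<phi>. styp \<phi> x \<in> Ob Q) \<and> (\<forall>y \<in> tgt \<phi>. ttyp \<phi> y \<in> Ob Q) \<and>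
     (\<forall>x \<in> src \<phi>. \<forall>y \<in> tgt \<phi>. rel \<phi> x y \<in> Arr Q (styp \<phi> x) (ttyp \<phi> y))"

definition kan_lower :: "('o, 'a, 'm) qtld_scheme \<Rightarrow> ('o, 'a, 'x, 'y) qrel \<Rightarrow>
    'o \<times> ('y \<Rightarrow> 'a) \<Rightarrow> 'o \<times> ('x \<Rightarrow> 'a)" where
  "kan_lower Q \<phi> = (\<lambda>(q, l). (q, \<lambda>x \<in> src \<phi>.
     \<Sqinter>\<^bsub>Hom Q q (styp \<phi> x)\<^esub> ((\<lambda>y. rimp Q q (styp \<phi> x) (ttyp \<phi> y) (rel \<phi> x y) (l y)) ` tgt \<phi>)))"

definition kan_upper :: "('o, 'a, 'm) qtld_scheme \<Rightarrow> ('o, 'a, 'x, 'y) qrel \<Rightarrow>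
    'o \<times> ('x \<Rightarrow> 'a) \<Rightarrow> 'o \<times> ('y \<Rightarrow> 'a)" where
  "kan_upper Q \<phi> = (\<lambda>(q, m). (q, \<lambda>y \<in> tgt \<phi>.
     \<Squnion>\<^bsub>Hom Q q (ttyp \<phi> y)\<^esub> ((\<lambda>x. Comp Q q (styp \<phi> x) (ttyp \<phi> y) (rel \<phi> x y) (m x)) ` src \<phi>)))"

definition K_dagger :: "('o, 'a, 'm) qtld_scheme \<Rightarrow> ('o, 'a, 'x, 'y) qrel \<Rightarrow>
    ('o, 'a, 'o \<times> ('y \<Rightarrow> 'a)) qcat" where
  "K_dagger Q \<phi> = (copresheaves Q (tgt \<phi>) (ttyp \<phi>))
     \<lparr>Obj := {l \<in> Obj (copresheaves Q (tgt \<phi>) (ttyp \<phi>)). kan_upper Q \<phi> (kan_lower Q \<phi> l) = l}\<rparr>"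


section \<open>Multi-adjoint object-oriented frames and their concept lattices\<close>

text \<open>Here \<open>amp i x z\<close> is \<open>x &\<^sub>i z\<close>, \<open>swa i y z\<close> is \<open>y \<swarrow>\<^sup>i z\<close>, and \<open>nwa i y x\<close> is \<open>y \<nwarrow>\<^sub>i x\<close>;
  only the indices \<open>1, \<dots>, n\<close> matter.\<close>

locale multi_adjoint_oo_frame =
  fixes n :: nat
    and amp :: "int \<Rightarrow> 'l1::complete_lattice \<Rightarrow> 'p::complete_lattice \<Rightarrow> 'l2::complete_lattice"
    and swa :: "int \<Rightarrow> 'l2 \<Rightarrow> 'p \<Rightarrow> 'l1"
    and nwa :: "int \<Rightarrow> 'l2 \<Rightarrow> 'l1 \<Rightarrow> 'p"
  assumes amp_swa: "i \<in> {1..int n} \<Longrightarrow> amp i x z \<le> y \<longleftrightarrow> x \<le> swa i y z"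
    and amp_nwa: "i \<in> {1..int n} \<Longrightarrow> amp i x z \<le> y \<longleftrightarrow> z \<le> nwa i y x"

definition oo_lower :: "(int \<Rightarrow> 'l2 \<Rightarrow> 'p \<Rightarrow> 'l1::complete_lattice) \<Rightarrow>
    'x set \<Rightarrow> 'y set \<Rightarrow> ('x \<Rightarrow> 'y \<Rightarrow> 'p) \<Rightarrow> ('y \<Rightarrow> int) \<Rightarrow> ('y \<Rightarrow> 'l2) \<Rightarrow> 'x \<Rightarrow> 'l1" where
  "oo_lower swa X Y \<phi> t l = (\<lambda>x \<in> X. INF y\<in>Y. swa (t y) (l y) (\<phi> x y))"

definition oo_upper :: "(int \<Rightarrow> 'l1 \<Rightarrow> 'p \<Rightarrow> 'l2::complete_lattice) \<Rightarrow>
    'x set \<Rightarrow> 'y set \<Rightarrow> ('x \<Rightarrow> 'y \<Rightarrow> 'p) \<Rightarrow> ('y \<Rightarrow> int) \<Rightarrow> ('x \<Rightarrow> 'l1) \<Rightarrow> 'y \<Rightarrow> 'l2" where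
  "oo_upper amp X Y \<phi> t m = (\<lambda>y \<in> Y. SUP x\<in>X. amp (t y) (m x) (\<phi> x y))"

definition oo_concept_lattice ::
    "(int \<Rightarrow> 'l1::complete_lattice \<Rightarrow> 'p \<Rightarrow> 'l2::complete_lattice) \<Rightarrow> (int \<Rightarrow> 'l2 \<Rightarrow> 'p \<Rightarrow> 'l1) \<Rightarrow>
     'x set \<Rightarrow> 'y set \<Rightarrow> ('x \<Rightarrow> 'y \<Rightarrow> 'p) \<Rightarrow> ('y \<Rightarrow> int) \<Rightarrow> (('y \<Rightarrow> 'l2) \<times> ('x \<Rightarrow> 'l1)) gorder" where
  "oo_concept_lattice amp swa X Y \<phi> t =
     \<lparr>carrier = {(l, m). l \<in> Y \<rightarrow>\<^sub>E UNIV \<and> m \<in> X \<rightarrow>\<^sub>E UNIV \<and>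
         oo_lower swa X Y \<phi> t l = m \<and> oo_upper amp X Y \<phi> t m = l},
      eq = (=),
      le = (\<lambda>(l\<^sub>1, m\<^sub>1) (l\<^sub>2, m\<^sub>2). \<forall>y \<in> Y. l\<^sub>2 y \<le> l\<^sub>1 y)\<rparr>"


section \<open>The quantaloid of a frame\<close>

text \<open>\<open>Zero\<close> is the bottom arrow of every endo-hom-set and the sole element of each trivial one;
  \<open>One\<close> is the identity arrow of every endo-hom-set.\<close>

datatype ('l1, 'l2, 'p) arrow = InL1 'l1 | InL2 'l2 | InP 'p | Zero | One

fun arrow_le :: "('l1::ord, 'l2::ord, 'p::ord) arrow \<Rightarrow> ('l1, 'l2, 'p) arrow \<Rightarrow> bool" where
  "arrow_le (InL1 a) (InL1 b) \<longleftrightarrow> a \<le> b"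
| "arrow_le (InL2 a) (InL2 b) \<longleftrightarrow> a \<le> b"
| "arrow_le (InP a) (InP b) \<longleftrightarrow> a \<le> b"
| "arrow_le Zero Zero \<longleftrightarrow> True"
| "arrow_le Zero One \<longleftrightarrow> True"
| "arrow_le One One \<longleftrightarrow> True"
| "arrow_le _ _ \<longleftrightarrow> False"

definition QO_hom :: "int \<Rightarrow> int \<Rightarrow> ('l1::ord, 'l2::ord, 'p::ord) arrow gorder" where
  "QO_hom p q = \<lparr>carrier =
       (if p = q then {Zero, One}
        else if p = -1 \<and> q = 0 then range InL1
        else if p = 0 \<and> q \<ge> 1 then range InP
        else if p = -1 \<and> q \<ge> 1 then range InL2
        else {Zero}),
     eq = (=), le = arrow_le\<rparr>"

fun QO_comp :: "(int \<Rightarrow> 'l1::ord \<Rightarrow> 'p::ord \<Rightarrow> 'l2::ord) \<Rightarrow> int \<Rightarrow> int \<Rightarrow> int \<Rightarrow>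
    ('l1, 'l2, 'p) arrow \<Rightarrow> ('l1, 'l2, 'p) arrow \<Rightarrow> ('l1, 'l2, 'p) arrow" where
  "QO_comp amp p q r One u = u"
| "QO_comp amp p q r v One = v"
| "QO_comp amp p q r (InP z) (InL1 x) = InL2 (amp r x z)"
| "QO_comp amp p q r _ _ = \<bottom>\<^bsub>QO_hom p r\<^esub>"

definition QO :: "nat \<Rightarrow> (int \<Rightarrow> 'l1::ord \<Rightarrow> 'p::ord \<Rightarrow> 'l2::ord) \<Rightarrow>
    (int, ('l1, 'l2, 'p) arrow) qtld" where
  "QO n amp = \<lparr>Ob = {-1..int n}, Hom = QO_hom, Comp = QO_comp amp, Ident = (\<lambda>_. One)\<rparr>"

definition phi_O :: "'x set \<Rightarrow> 'y set \<Rightarrow> ('x \<Rightarrow> 'y \<Rightarrow> 'p) \<Rightarrow> ('y \<Rightarrow> int) \<Rightarrow>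
    (int, ('l1, 'l2, 'p) arrow, 'x, 'y) qrel" where
  "phi_O X Y \<phi> t =
     \<lparr>src = X, styp = (\<lambda>_. 0), tgt = Y, ttyp = t, rel = (\<lambda>x y. InP (\<phi> x y))\<rparr>"


section \<open>Isomorphism of complete lattices\<close>

definition complete_lattice_iso :: "'a gorder \<Rightarrow> 'b gorder \<Rightarrow> ('a \<Rightarrow> 'b) \<Rightarrow> bool" where
  "complete_lattice_iso L M h \<longleftrightarrow>
     bij_betw h (carrier L) (carrier M) \<and>
     (\<forall>x \<in> carrier L. \<forall>y \<in> carrier L. x \<sqsubseteq>\<^bsub>L\<^esub> y \<longleftrightarrow> h x \<sqsubseteq>\<^bsub>M\<^esub> h y) \<and>
     sup_pres L M h \<and> inf_pres L M h"

definition isomorphic_complete_lattices :: "'a gorder \<Rightarrow> 'b gorder \<Rightarrow> bool" where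
  "isomorphic_complete_lattices L M \<longleftrightarrow> (\<exists>h. complete_lattice_iso L M h)"


section \<open>Fixed points of the dual Kan adjunction form a complete category\<close>

context quantaloid
begin

lemma Comp_mono_right:
  assumes "p \<in> Ob Q" "q \<in> Ob Q" "r \<in> Ob Q" "u \<in> Arr Q p q" "u' \<in> Arr Q p q" "v \<in> Arr Q q r"
    "u \<sqsubseteq>\<^bsub>Hom Q p q\<^esub> u'"
  shows "Comp Q p q r v u \<sqsubseteq>\<^bsub>Hom Q p r\<^esub> Comp Q p q r v u'"
proof -
  interpret pq: complete_lattice "Hom Q p q" using assms Hom_complete by blast
  interpret pr: complete_lattice "Hom Q p r" using assms Hom_complete by blast
  have "\<Squnion>\<^bsub>Hom Q p q\<^esub> {u, u'} = u'"
    using assms by (intro pq.le_antisym pq.weak.sup_least pq.weak.sup_upper) auto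
  then have "Comp Q p q r v u' = \<Squnion>\<^bsub>Hom Q p r\<^esub> {Comp Q p q r v u, Comp Q p q r v u'}"
    using Comp_Sup_right[of p q r "{u, u'}" v] assms by auto
  then show ?thesis
    using pr.weak.sup_upper[of "{Comp Q p q r v u, Comp Q p q r v u'}"] assms
    by (metis Comp_closed empty_subsetI insert_subset insertI1)
qed

lemma Comp_mono_left:
  assumes "p \<in> Ob Q" "q \<in> Ob Q" "r \<in> Ob Q" "u \<in> Arr Q p q" "v \<in> Arr Q q r" "v' \<in> Arr Q q r"
    "v \<sqsubseteq>\<^bsub>Hom Q q r\<^esub> v'"
  shows "Comp Q p q r v u \<sqsubseteq>\<^bsub>Hom Q p r\<^esub> Comp Q p q r v' u"
proof -
  interpret qr: complete_lattice "Hom Q q r" using assms Hom_complete by blast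
  interpret pr: complete_lattice "Hom Q p r" using assms Hom_complete by blast
  have "\<Squnion>\<^bsub>Hom Q q r\<^esub> {v, v'} = v'"
    using assms by (intro qr.le_antisym qr.weak.sup_least qr.weak.sup_upper) auto
  then have "Comp Q p q r v' u = \<Squnion>\<^bsub>Hom Q p r\<^esub> {Comp Q p q r v u, Comp Q p q r v' u}"
    using Comp_Sup_left[of p q r u "{v, v'}"] assms by auto
  then show ?thesis
    using pr.weak.sup_upper[of "{Comp Q p q r v u, Comp Q p q r v' u}"] assms
    by (metis Comp_closed empty_subsetI insert_subset insertI1)
qed

lemma rimp_char:
  assumes Ob: "p \<in> Ob Q" "q \<in> Ob Q" "r \<in> Ob Q" and v: "v \<in> Arr Q q r" and w: "w \<in> Arr Q p r"
  shows "rimp Q p q r v w \<in> Arr Q p q \<and>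
    (\<forall>u \<in> Arr Q p q. Comp Q p q r v u \<sqsubseteq>\<^bsub>Hom Q p r\<^esub> w \<longleftrightarrow> u \<sqsubseteq>\<^bsub>Hom Q p q\<^esub> rimp Q p q r v w)"
proof -
  interpret pq: complete_lattice "Hom Q p q" using Ob Hom_complete by blast
  interpret pr: complete_lattice "Hom Q p r" using Ob Hom_complete by blast
  let ?S = "{u \<in> Arr Q p q. Comp Q p q r v u \<sqsubseteq>\<^bsub>Hom Q p r\<^esub> w}"
  let ?s = "\<Squnion>\<^bsub>Hom Q p q\<^esub> ?S"
  have s: "?s \<in> Arr Q p q" by (rule pq.weak.sup_closed) auto
  have "Comp Q p q r v ?s = \<Squnion>\<^bsub>Hom Q p r\<^esub> ((\<lambda>u. Comp Q p q r v u) ` ?S)"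
    using Ob v by (intro Comp_Sup_right) auto
  also have "\<dots> \<sqsubseteq>\<^bsub>Hom Q p r\<^esub> w"
    using Ob v w by (intro pr.weak.sup_least) (auto intro: Comp_closed)
  finally have sw: "Comp Q p q r v ?s \<sqsubseteq>\<^bsub>Hom Q p r\<^esub> w" .
  show ?thesis
    unfolding rimp_def
  proof (rule theI[where a = ?s], intro conjI ballI iffI)
    show "?s \<in> Arr Q p q" by (fact s)
  next
    fix u assume "u \<in> Arr Q p q" "Comp Q p q r v u \<sqsubseteq>\<^bsub>Hom Q p r\<^esub> w"
    then show "u \<sqsubseteq>\<^bsub>Hom Q p q\<^esub> ?s" by (intro pq.weak.sup_upper) auto
  next
    fix u assume u: "u \<in> Arr Q p q" "u \<sqsubseteq>\<^bsub>Hom Q p q\<^esub> ?s"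
    have "Comp Q p q r v u \<sqsubseteq>\<^bsub>Hom Q p r\<^esub> Comp Q p q r v ?s"
      using Comp_mono_right u s Ob v by blast
    then show "Comp Q p q r v u \<sqsubseteq>\<^bsub>Hom Q p r\<^esub> w"
      using sw Comp_closed Ob v w u s pr.le_trans by meson
  next
    fix x assume "x \<in> Arr Q p q \<and>
      (\<forall>u\<in>Arr Q p q. (Comp Q p q r v u \<sqsubseteq>\<^bsub>Hom Q p r\<^esub> w) = (u \<sqsubseteq>\<^bsub>Hom Q p q\<^esub> x))"
    then show "x = ?s"
      using s sw by (intro pq.le_antisym pq.weak.sup_upper pq.weak.sup_least) auto
  qed
qed

lemmas rimp_closed = rimp_char[THEN conjunct1]

lemma rimp_iff:
  "\<lbrakk>p \<in> Ob Q; q \<in> Ob Q; r \<in> Ob Q; v \<in> Arr Q q r; w \<in> Arr Q p r; u \<in> Arr Q p q\<rbrakk>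
   \<Longrightarrow> u \<sqsubseteq>\<^bsub>Hom Q p q\<^esub> rimp Q p q r v w \<longleftrightarrow> Comp Q p q r v u \<sqsubseteq>\<^bsub>Hom Q p r\<^esub> w"
  using rimp_char by blast

lemma Inf_iff:
  assumes "p \<in> Ob Q" "q \<in> Ob Q" "f \<in> I \<rightarrow> Arr Q p q" "u \<in> Arr Q p q"
  shows "u \<sqsubseteq>\<^bsub>Hom Q p q\<^esub> \<Sqinter>\<^bsub>Hom Q p q\<^esub> (f ` I) \<longleftrightarrow> (\<forall>i \<in> I. u \<sqsubseteq>\<^bsub>Hom Q p q\<^esub> f i)"
proof -
  interpret pq: complete_lattice "Hom Q p q" using assms Hom_complete by blast
  have I: "f ` I \<subseteq> Arr Q p q" using assms by auto
  show ?thesis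
  proof
    assume l: "u \<sqsubseteq>\<^bsub>Hom Q p q\<^esub> \<Sqinter>\<^bsub>Hom Q p q\<^esub> (f ` I)"
    show "\<forall>i \<in> I. u \<sqsubseteq>\<^bsub>Hom Q p q\<^esub> f i"
    proof
      fix i assume "i \<in> I"
      then have "\<Sqinter>\<^bsub>Hom Q p q\<^esub> (f ` I) \<sqsubseteq>\<^bsub>Hom Q p q\<^esub> f i" by (intro pq.weak.inf_lower I) auto
      with l show "u \<sqsubseteq>\<^bsub>Hom Q p q\<^esub> f i"
        using pq.le_trans[OF l] assms I \<open>i \<in> I\<close> pq.weak.inf_closed[OF I] by auto
    qed
  qed (use I assms in \<open>auto intro: pq.weak.inf_greatest\<close>)
qed

lemma Inf_closed:
  assumes "p \<in> Ob Q" "q \<in> Ob Q" "f \<in> I \<rightarrow> Arr Q p q"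
  shows "\<Sqinter>\<^bsub>Hom Q p q\<^esub> (f ` I) \<in> Arr Q p q"
proof -
  interpret pq: complete_lattice "Hom Q p q" using assms Hom_complete by blast
  show ?thesis using assms by (intro pq.weak.inf_closed) auto
qed

lemma Sup_closed:
  assumes "p \<in> Ob Q" "q \<in> Ob Q" "f \<in> I \<rightarrow> Arr Q p q"
  shows "\<Squnion>\<^bsub>Hom Q p q\<^esub> (f ` I) \<in> Arr Q p q"
proof -
  interpret pq: complete_lattice "Hom Q p q" using assms Hom_complete by blast
  show ?thesis using assms by (intro pq.weak.sup_closed) auto
qed

lemma Sup_iff:
  assumes "p \<in> Ob Q" "q \<in> Ob Q" "f \<in> I \<rightarrow> Arr Q p q" "u \<in> Arr Q p q"
  shows "\<Squnion>\<^bsub>Hom Q p q\<^esub> (f ` I) \<sqsubseteq>\<^bsub>Hom Q p q\<^esub> u \<longleftrightarrow> (\<forall>i \<in> I. f i \<sqsubseteq>\<^bsub>Hom Q p q\<^esub> u)"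
proof -
  interpret pq: complete_lattice "Hom Q p q" using assms Hom_complete by blast
  have I: "f ` I \<subseteq> Arr Q p q" using assms by auto
  show ?thesis
  proof
    assume l: "\<Squnion>\<^bsub>Hom Q p q\<^esub> (f ` I) \<sqsubseteq>\<^bsub>Hom Q p q\<^esub> u"
    show "\<forall>i \<in> I. f i \<sqsubseteq>\<^bsub>Hom Q p q\<^esub> u"
    proof
      fix i assume "i \<in> I"
      then have "f i \<sqsubseteq>\<^bsub>Hom Q p q\<^esub> \<Squnion>\<^bsub>Hom Q p q\<^esub> (f ` I)" by (intro pq.weak.sup_upper I) auto
      with l show "f i \<sqsubseteq>\<^bsub>Hom Q p q\<^esub> u"
        using pq.le_trans[OF _ l] assms I \<open>i \<in> I\<close> pq.weak.sup_closed[OF I] by auto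
    qed
  qed (use I assms in \<open>auto intro: pq.weak.sup_least\<close>)
qed

lemma arr_eqI:
  assumes "p \<in> Ob Q" "q \<in> Ob Q" "a \<in> Arr Q p q" "b \<in> Arr Q p q"
    "\<And>u. u \<in> Arr Q p q \<Longrightarrow> u \<sqsubseteq>\<^bsub>Hom Q p q\<^esub> a \<longleftrightarrow> u \<sqsubseteq>\<^bsub>Hom Q p q\<^esub> b"
  shows "a = b"
proof -
  interpret pq: complete_lattice "Hom Q p q" using assms Hom_complete by blast
  show ?thesis using assms by (intro pq.le_antisym) auto
qed

lemma le_refl: "\<lbrakk>p \<in> Ob Q; q \<in> Ob Q; a \<in> Arr Q p q\<rbrakk> \<Longrightarrow> a \<sqsubseteq>\<^bsub>Hom Q p q\<^esub> a"
  by (meson Hom_complete complete_lattice.axioms(1) partial_order.axioms(1) weak_partial_order.le_refl)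

lemma le_trans:
  assumes "a \<sqsubseteq>\<^bsub>Hom Q p q\<^esub> b" "b \<sqsubseteq>\<^bsub>Hom Q p q\<^esub> c" "p \<in> Ob Q" "q \<in> Ob Q"
    "a \<in> Arr Q p q" "b \<in> Arr Q p q" "c \<in> Arr Q p q"
  shows "a \<sqsubseteq>\<^bsub>Hom Q p q\<^esub> c"
proof -
  interpret pq: complete_lattice "Hom Q p q" using assms Hom_complete by blast
  show ?thesis using assms pq.le_trans by blast
qed

lemma rimp_Comp_le:
  "\<lbrakk>p \<in> Ob Q; q \<in> Ob Q; r \<in> Ob Q; v \<in> Arr Q q r; w \<in> Arr Q p r\<rbrakk>
   \<Longrightarrow> Comp Q p q r v (rimp Q p q r v w) \<sqsubseteq>\<^bsub>Hom Q p r\<^esub> w"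
  by (meson rimp_iff rimp_closed le_refl)

lemma copresheaves_simps:
  "x \<in> Obj (copresheaves Q Y t) \<longleftrightarrow> fst x \<in> Ob Q \<and> snd x \<in> (\<Pi>\<^sub>E y \<in> Y. Arr Q (fst x) (t y))"
  "otype (copresheaves Q Y t) = fst"
  "qhom (copresheaves Q Y t) x x' =
     \<Sqinter>\<^bsub>Hom Q (fst x) (fst x')\<^esub> ((\<lambda>y. rimp Q (fst x) (fst x') (t y) (snd x' y) (snd x y)) ` Y)"
  by (auto simp: copresheaves_def split: prod.splits)

lemma copresheaves_hom_closed:
  assumes "\<And>y. y \<in> Y \<Longrightarrow> t y \<in> Ob Q" "x \<in> Obj (copresheaves Q Y t)" "x' \<in> Obj (copresheaves Q Y t)"
  shows "qhom (copresheaves Q Y t) x x' \<in> Arr Q (fst x) (fst x')"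
  using assms unfolding copresheaves_simps
  by (intro Inf_closed) (auto intro!: rimp_closed dest: PiE_mem)

lemma copresheaves_hom_iff:
  assumes "\<And>y. y \<in> Y \<Longrightarrow> t y \<in> Ob Q" "x \<in> Obj (copresheaves Q Y t)" "x' \<in> Obj (copresheaves Q Y t)"
    "u \<in> Arr Q (fst x) (fst x')"
  shows "u \<sqsubseteq>\<^bsub>Hom Q (fst x) (fst x')\<^esub> qhom (copresheaves Q Y t) x x' \<longleftrightarrow>
    (\<forall>y \<in> Y. Comp Q (fst x) (fst x') (t y) (snd x' y) u \<sqsubseteq>\<^bsub>Hom Q (fst x) (t y)\<^esub> snd x y)"
proof -
  have "u \<sqsubseteq>\<^bsub>Hom Q (fst x) (fst x')\<^esub> qhom (copresheaves Q Y t) x x' \<longleftrightarrow>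
    (\<forall>y \<in> Y. u \<sqsubseteq>\<^bsub>Hom Q (fst x) (fst x')\<^esub> rimp Q (fst x) (fst x') (t y) (snd x' y) (snd x y))"
    using assms unfolding copresheaves_simps
    by (intro Inf_iff) (auto intro!: rimp_closed dest: PiE_mem)
  also have "\<dots> \<longleftrightarrow> (\<forall>y \<in> Y. Comp Q (fst x) (fst x') (t y) (snd x' y) u \<sqsubseteq>\<^bsub>Hom Q (fst x) (t y)\<^esub> snd x y)"
    using assms unfolding copresheaves_simps
    by (intro ball_cong refl rimp_iff) (auto dest: PiE_mem)
  finally show ?thesis .
qed

lemma copresheaves_qcategory:
  assumes t: "\<And>y. y \<in> Y \<Longrightarrow> t y \<in> Ob Q"
  shows "qcategory Q (copresheaves Q Y t)"
  unfolding qcategory_def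
proof (intro conjI ballI)
  let ?A = "copresheaves Q Y t"
  note cl = copresheaves_hom_closed[of Y t, OF t]
  note iff = copresheaves_hom_iff[of Y t, OF t]
  show "otype ?A x \<in> Ob Q" if "x \<in> Obj ?A" for x using that by (simp add: copresheaves_simps)
  show "qhom ?A x y \<in> Arr Q (otype ?A x) (otype ?A y)" if "x \<in> Obj ?A" "y \<in> Obj ?A" for x y
    using cl that by (simp add: copresheaves_simps(2))
  show "Ident Q (otype ?A x) \<sqsubseteq>\<^bsub>Hom Q (otype ?A x) (otype ?A x)\<^esub> qhom ?A x x" if x: "x \<in> Obj ?A" for x
  proof -
    have x': "fst x \<in> Ob Q" "snd x y \<in> Arr Q (fst x) (t y)" if "y \<in> Y" for y
      using x that by (auto simp: copresheaves_simps dest: PiE_mem)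
    have "fst x \<in> Ob Q" using x by (auto simp: copresheaves_simps)
    then show ?thesis unfolding copresheaves_simps(2)
      by (subst iff[OF _ x x]) (auto simp: Ident_closed Comp_Ident_right x' t le_refl)
  qed
  show "Comp Q (otype ?A x) (otype ?A y) (otype ?A z) (qhom ?A y z) (qhom ?A x y)
      \<sqsubseteq>\<^bsub>Hom Q (otype ?A x) (otype ?A z)\<^esub> qhom ?A x z"
    if o: "x \<in> Obj ?A" "y \<in> Obj ?A" "z \<in> Obj ?A" for x y z
  proof -
    have o': "fst x \<in> Ob Q" "fst y \<in> Ob Q" "fst z \<in> Ob Q"
      using o by (auto simp: copresheaves_simps)
    have s: "snd x i \<in> Arr Q (fst x) (t i)" "snd y i \<in> Arr Q (fst y) (t i)"
      "snd z i \<in> Arr Q (fst z) (t i)" if "i \<in> Y" for i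
      using o that by (auto simp: copresheaves_simps dest: PiE_mem)
    have yz: "qhom ?A y z \<in> Arr Q (fst y) (fst z)" and xy: "qhom ?A x y \<in> Arr Q (fst x) (fst y)"
      using cl o by auto
    have yz': "Comp Q (fst y) (fst z) (t i) (snd z i) (qhom ?A y z) \<sqsubseteq>\<^bsub>Hom Q (fst y) (t i)\<^esub> snd y i"
      if "i \<in> Y" for i
      using iff[OF _ o(2,3) yz] le_refl[OF o'(2,3) yz] that by blast
    have xy': "Comp Q (fst x) (fst y) (t i) (snd y i) (qhom ?A x y) \<sqsubseteq>\<^bsub>Hom Q (fst x) (t i)\<^esub> snd x i"
      if "i \<in> Y" for i
      using iff[OF _ o(1,2) xy] le_refl[OF o'(1,2) xy] that by blast
    have "Comp Q (fst x) (fst z) (t i) (snd z i) (Comp Q (fst x) (fst y) (fst z) (qhom ?A y z) (qhom ?A x y))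
      \<sqsubseteq>\<^bsub>Hom Q (fst x) (t i)\<^esub> snd x i" if i: "i \<in> Y" for i
    proof -
      have "Comp Q (fst x) (fst y) (t i) (Comp Q (fst y) (fst z) (t i) (snd z i) (qhom ?A y z)) (qhom ?A x y)
        \<sqsubseteq>\<^bsub>Hom Q (fst x) (t i)\<^esub> Comp Q (fst x) (fst y) (t i) (snd y i) (qhom ?A x y)"
        using o' t[OF i] xy yz s[OF i] yz'[OF i] by (intro Comp_mono_left Comp_closed) auto
      then have "Comp Q (fst x) (fst y) (t i) (Comp Q (fst y) (fst z) (t i) (snd z i) (qhom ?A y z)) (qhom ?A x y)
        \<sqsubseteq>\<^bsub>Hom Q (fst x) (t i)\<^esub> snd x i"
        by (rule le_trans[OF _ xy'[OF i]]) (use o' t[OF i] xy yz s[OF i] in \<open>auto intro: Comp_closed\<close>)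
      then show ?thesis using Comp_assoc[OF o' t[OF i] xy yz s(3)[OF i]] by simp
    qed
    moreover have "Comp Q (fst x) (fst y) (fst z) (qhom ?A y z) (qhom ?A x y) \<in> Arr Q (fst x) (fst z)"
      using o' xy yz by (intro Comp_closed) auto
    ultimately show ?thesis unfolding copresheaves_simps(2)
      using iff[OF _ o(1,3)] by blast
  qed
qed

lemma K_dagger_qcategory:
  assumes "qrelation Q \<phi>"
  shows "qcategory Q (K_dagger Q \<phi>)"
  using copresheaves_qcategory[of "tgt \<phi>" "ttyp \<phi>"] assms
  unfolding qrelation_def qcategory_def K_dagger_def by simp

lemma Sup_upper:
  "\<lbrakk>p \<in> Ob Q; q \<in> Ob Q; f \<in> I \<rightarrow> Arr Q p q; i \<in> I\<rbrakk>
   \<Longrightarrow> f i \<sqsubseteq>\<^bsub>Hom Q p q\<^esub> \<Squnion>\<^bsub>Hom Q p q\<^esub> (f ` I)"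
  using Sup_iff[of p q f I "\<Squnion>\<^bsub>Hom Q p q\<^esub> (f ` I)"] Sup_closed[of p q f I]
    le_refl[of p q "\<Squnion>\<^bsub>Hom Q p q\<^esub> (f ` I)"] by blast

lemma K_dagger_complete:
  assumes \<phi>: "qrelation Q \<phi>"
  shows "complete_qcategory Q (K_dagger Q \<phi>)"
  unfolding complete_qcategory_def
proof (intro conjI ballI allI impI)
  show "qcategory Q (K_dagger Q \<phi>)" using K_dagger_qcategory[OF \<phi>] .
next
  define X Y s t R where "X = src \<phi>" and "Y = tgt \<phi>" and "s = styp \<phi>" and "t = ttyp \<phi>"
    and "R = rel \<phi>"
  note defs = X_def Y_def s_def t_def R_def
  let ?P = "copresheaves Q Y t" and ?A = "K_dagger Q \<phi>"
  have s: "x \<in> X \<Longrightarrow> s x \<in> Ob Q" and t: "y \<in> Y \<Longrightarrow> t y \<in> Ob Q"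
    and R: "x \<in> X \<Longrightarrow> y \<in> Y \<Longrightarrow> R x y \<in> Arr Q (s x) (t y)" for x y
    using \<phi> unfolding qrelation_def defs by auto
  have A_typ: "otype ?A = fst" and A_hom: "qhom ?A = qhom ?P"
    and A_obj: "x \<in> Obj ?A \<longleftrightarrow> x \<in> Obj ?P \<and> kan_upper Q \<phi> (kan_lower Q \<phi> x) = x" for x
    unfolding K_dagger_def defs by (simp_all add: copresheaves_simps(2))
  define L where "L x = snd (kan_lower Q \<phi> x)" for x
  define U where "U x = snd (kan_upper Q \<phi> (kan_lower Q \<phi> x))" for x
  have P: "fst x \<in> Ob Q" "\<And>y. y \<in> Y \<Longrightarrow> snd x y \<in> Arr Q (fst x) (t y)" if "x \<in> Obj ?P" for x
    using that by (auto simp: copresheaves_simps dest: PiE_mem)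
  have L_eq: "L x i = \<Sqinter>\<^bsub>Hom Q (fst x) (s i)\<^esub> ((\<lambda>y. rimp Q (fst x) (s i) (t y) (R i y) (snd x y)) ` Y)"
    if "i \<in> X" for x i
    using that by (cases x) (simp add: L_def kan_lower_def defs)
  have L_closed: "L x i \<in> Arr Q (fst x) (s i)" if "x \<in> Obj ?P" "i \<in> X" for x i
    using P[OF that(1)] s[OF that(2)] t R[OF that(2)] unfolding L_eq[OF that(2)]
    by (intro Inf_closed) (auto intro!: rimp_closed)
  have L_iff: "u \<sqsubseteq>\<^bsub>Hom Q (fst x) (s i)\<^esub> L x i \<longleftrightarrow>
      (\<forall>y \<in> Y. Comp Q (fst x) (s i) (t y) (R i y) u \<sqsubseteq>\<^bsub>Hom Q (fst x) (t y)\<^esub> snd x y)"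
    if "x \<in> Obj ?P" "i \<in> X" "u \<in> Arr Q (fst x) (s i)" for x i u
  proof -
    have "u \<sqsubseteq>\<^bsub>Hom Q (fst x) (s i)\<^esub> L x i \<longleftrightarrow>
      (\<forall>y \<in> Y. u \<sqsubseteq>\<^bsub>Hom Q (fst x) (s i)\<^esub> rimp Q (fst x) (s i) (t y) (R i y) (snd x y))"
      using P[OF that(1)] s[OF that(2)] t R[OF that(2)] that(3) unfolding L_eq[OF that(2)]
      by (intro Inf_iff) (auto intro!: rimp_closed)
    also have "\<dots> \<longleftrightarrow> (\<forall>y \<in> Y. Comp Q (fst x) (s i) (t y) (R i y) u \<sqsubseteq>\<^bsub>Hom Q (fst x) (t y)\<^esub> snd x y)"
      using P[OF that(1)] s[OF that(2)] t R[OF that(2)] that(3)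
      by (intro ball_cong refl rimp_iff) auto
    finally show ?thesis .
  qed
  have U_eq: "U x y = \<Squnion>\<^bsub>Hom Q (fst x) (t y)\<^esub> ((\<lambda>i. Comp Q (fst x) (s i) (t y) (R i y) (L x i)) ` X)"
    if "y \<in> Y" for x y
    using that by (cases x) (simp add: U_def L_def kan_upper_def kan_lower_def defs)
  have fix_iff: "kan_upper Q \<phi> (kan_lower Q \<phi> x) = x \<longleftrightarrow> (\<forall>y \<in> Y. U x y = snd x y)"
    if "x \<in> Obj ?P" for x
  proof -
    have "fst (kan_upper Q \<phi> (kan_lower Q \<phi> x)) = fst x" and "U x \<in> extensional Y"
      by (cases x; simp add: kan_upper_def kan_lower_def U_def defs)+
    moreover have "snd x \<in> extensional Y" using that by (auto simp: copresheaves_simps PiE_def)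
    ultimately show ?thesis unfolding U_def
      by (auto simp: prod_eq_iff intro!: extensionalityI[of _ Y])
  qed
  fix q l
  assume q: "q \<in> Ob Q" and l': "(\<forall>x\<in>Obj ?A. l x \<in> Arr Q q (otype ?A x)) \<and>
    (\<forall>x\<in>Obj ?A. \<forall>y\<in>Obj ?A. Comp Q q (otype ?A x) (otype ?A y) (qhom ?A x y) (l x)
       \<sqsubseteq>\<^bsub>Hom Q q (otype ?A y)\<^esub> l y)"
  then have l: "l x \<in> Arr Q q (fst x)" if "x \<in> Obj ?A" for x using that by (auto simp: A_typ)
  define f where "f y x = Comp Q q (fst x) (t y) (snd x y) (l x)" for y x
  define a where "a = (q, \<lambda>y\<in>Y. \<Squnion>\<^bsub>Hom Q q (t y)\<^esub> (f y ` Obj ?A))"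
  have AP: "x \<in> Obj ?A \<Longrightarrow> x \<in> Obj ?P" for x by (simp add: A_obj)
  have f: "f y x \<in> Arr Q q (t y)" if "y \<in> Y" "x \<in> Obj ?A" for x y
    unfolding f_def using that l P[OF AP] q t by (intro Comp_closed) auto
  have fa: "fst a = q" and sa: "snd a y = \<Squnion>\<^bsub>Hom Q q (t y)\<^esub> (f y ` Obj ?A)" if "y \<in> Y" for y
    using that by (auto simp: a_def)
  have fa: "fst a = q" by (simp add: a_def)
  have aP: "a \<in> Obj ?P"
    unfolding copresheaves_simps(1) using f q t by (auto simp: a_def intro!: Sup_closed)
  have L_le: "Comp Q q (fst x) (s i) (L x i) (l x) \<sqsubseteq>\<^bsub>Hom Q q (s i)\<^esub> L a i"
    if x: "x \<in> Obj ?A" and i: "i \<in> X" for x i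
  proof -
    have c: "Comp Q q (fst x) (s i) (L x i) (l x) \<in> Arr Q q (s i)"
      using x i q s P[OF AP[OF x]] l[OF x] L_closed[OF AP[OF x] i] by (intro Comp_closed) auto
    have "Comp Q q (s i) (t y) (R i y) (Comp Q q (fst x) (s i) (L x i) (l x))
      \<sqsubseteq>\<^bsub>Hom Q q (t y)\<^esub> snd a y" if y: "y \<in> Y" for y
    proof -
      note o = q P(1)[OF AP[OF x]] s[OF i] t[OF y]
      note m = l[OF x] L_closed[OF AP[OF x] i] R[OF i y] P(2)[OF AP[OF x] y]
      have "Comp Q (fst x) (s i) (t y) (R i y) (L x i) \<sqsubseteq>\<^bsub>Hom Q (fst x) (t y)\<^esub> snd x y"
        using L_iff[OF AP[OF x] i m(2)] le_refl[OF o(2,3) m(2)] y by blast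
      then have "Comp Q q (fst x) (t y) (Comp Q (fst x) (s i) (t y) (R i y) (L x i)) (l x)
        \<sqsubseteq>\<^bsub>Hom Q q (t y)\<^esub> f y x"
        unfolding f_def using o m by (intro Comp_mono_left Comp_closed) auto
      moreover have "f y x \<sqsubseteq>\<^bsub>Hom Q q (t y)\<^esub> snd a y"
        unfolding sa[OF y] using o f y x by (intro Sup_upper) auto
      ultimately have "Comp Q q (fst x) (t y) (Comp Q (fst x) (s i) (t y) (R i y) (L x i)) (l x)
        \<sqsubseteq>\<^bsub>Hom Q q (t y)\<^esub> snd a y"
        by (rule le_trans) (use o m f[OF y x] P(2)[OF aP y] fa in \<open>auto intro: Comp_closed\<close>)
      then show ?thesis using Comp_assoc[OF o m(1-3)] by simp
    qed
    then show ?thesis using L_iff[OF aP i] c by (simp add: fa)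
  qed
  have Uc: "Comp Q (fst x) (s i) (t y) (R i y) (L x i) \<in> Arr Q (fst x) (t y)"
    if "x \<in> Obj ?P" "i \<in> X" "y \<in> Y" for x i y
    using P[OF that(1)] s[OF that(2)] t R[OF that(2)] L_closed[OF that(1,2)] that(3)
    by (intro Comp_closed) auto
  have Ua: "U a y = snd a y" if y: "y \<in> Y" for y
  proof -
    interpret qy: complete_lattice "Hom Q q (t y)" using q t y Hom_complete by blast
    have Ucl: "U a y \<in> Arr Q q (t y)" unfolding U_eq[OF y] fa using q t y Uc[OF aP] fa
      by (intro Sup_closed) auto
    have acl: "snd a y \<in> Arr Q q (t y)" using P(2)[OF aP y] fa by simp
    show ?thesis
    proof (rule qy.le_antisym[OF _ _ Ucl acl])
      show "U a y \<sqsubseteq>\<^bsub>Hom Q q (t y)\<^esub> snd a y"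
        unfolding U_eq[OF y] fa
      proof (subst Sup_iff[OF q t[OF y] _ acl])
        show "(\<lambda>i. Comp Q q (s i) (t y) (R i y) (L a i)) \<in> X \<rightarrow> Arr Q q (t y)"
          using Uc[OF aP _ y] fa by auto
        show "\<forall>i\<in>X. Comp Q q (s i) (t y) (R i y) (L a i) \<sqsubseteq>\<^bsub>Hom Q q (t y)\<^esub> snd a y"
          using L_iff[OF aP] L_closed[OF aP] le_refl s q y fa by fastforce
      qed
      have "f y x \<sqsubseteq>\<^bsub>Hom Q q (t y)\<^esub> U a y" if x: "x \<in> Obj ?A" for x
      proof -
        note o = q P(1)[OF AP[OF x]] t[OF y]
        let ?g = "\<lambda>i. Comp Q (fst x) (s i) (t y) (R i y) (L x i)"
        have g: "?g i \<in> Arr Q (fst x) (t y)" if "i \<in> X" for i using Uc[OF AP[OF x] that y] .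
        have "snd x y = \<Squnion>\<^bsub>Hom Q (fst x) (t y)\<^esub> (?g ` X)"
          using U_eq[OF y] fix_iff[OF AP[OF x]] x y A_obj by metis
        then have "f y x = \<Squnion>\<^bsub>Hom Q q (t y)\<^esub> ((\<lambda>v. Comp Q q (fst x) (t y) v (l x)) ` ?g ` X)"
          unfolding f_def using g by (simp only:) (rule Comp_Sup_left[OF o l[OF x]], auto)
        also have "\<dots> \<sqsubseteq>\<^bsub>Hom Q q (t y)\<^esub> U a y"
          unfolding image_image
        proof (subst Sup_iff[OF o(1,3) _ Ucl], goal_cases)
          case 1 show ?case using g o l[OF x] by (auto intro: Comp_closed)
        next
          case 2 show ?case
          proof
            fix i assume i: "i \<in> X"
            note m = l[OF x] L_closed[OF AP[OF x] i] R[OF i y]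
            have La: "L a i \<in> Arr Q q (s i)" using L_closed[OF aP i] fa by simp
            have "Comp Q q (s i) (t y) (R i y) (Comp Q q (fst x) (s i) (L x i) (l x))
              \<sqsubseteq>\<^bsub>Hom Q q (t y)\<^esub> Comp Q q (s i) (t y) (R i y) (L a i)"
              using o s[OF i] m La L_le[OF x i] by (intro Comp_mono_right Comp_closed) auto
            moreover have "Comp Q q (s i) (t y) (R i y) (L a i) \<sqsubseteq>\<^bsub>Hom Q q (t y)\<^esub> U a y"
              unfolding U_eq[OF y] fa
              by (rule Sup_upper) (use o i Uc[OF aP _ y] fa in auto)
            ultimately have "Comp Q q (s i) (t y) (R i y) (Comp Q q (fst x) (s i) (L x i) (l x))
              \<sqsubseteq>\<^bsub>Hom Q q (t y)\<^esub> U a y"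
              by (rule le_trans) (use o s[OF i] m La Ucl in \<open>auto intro!: Comp_closed\<close>)
            then show "Comp Q q (fst x) (t y) (?g i) (l x) \<sqsubseteq>\<^bsub>Hom Q q (t y)\<^esub> U a y"
              using Comp_assoc[OF o(1,2) s[OF i] o(3) m] by simp
          qed
        qed
        finally show ?thesis .
      qed
      then show "snd a y \<sqsubseteq>\<^bsub>Hom Q q (t y)\<^esub> U a y"
        unfolding sa[OF y] using q t[OF y] f[OF y] Ucl by (subst Sup_iff) auto
    qed
  qed
  then have aA: "a \<in> Obj ?A" using A_obj aP fix_iff by blast
  have "qhom ?A z a = \<Sqinter>\<^bsub>Hom Q (fst z) q\<^esub> ((\<lambda>x. rimp Q (fst z) q (fst x) (l x) (qhom ?A z x)) ` Obj ?A)"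
    if z: "z \<in> Obj ?A" for z
  proof (rule arr_eqI)
    note zP = AP[OF z]
    show zo: "fst z \<in> Ob Q" using P zP by blast
    show "q \<in> Ob Q" by fact
    show "qhom ?A z a \<in> Arr Q (fst z) q"
      using copresheaves_hom_closed[OF _ zP aP] t by (simp add: A_hom fa)
    have hz: "qhom ?A z x \<in> Arr Q (fst z) (fst x)" if "x \<in> Obj ?A" for x
      using copresheaves_hom_closed[OF _ zP AP[OF that]] t by (simp add: A_hom)
    have rc: "(\<lambda>x. rimp Q (fst z) q (fst x) (l x) (qhom ?A z x)) \<in> Obj ?A \<rightarrow> Arr Q (fst z) q"
      using zo q P(1)[OF AP] l hz by (auto intro!: rimp_closed)
    show "\<Sqinter>\<^bsub>Hom Q (fst z) q\<^esub> ((\<lambda>x. rimp Q (fst z) q (fst x) (l x) (qhom ?A z x)) ` Obj ?A)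
      \<in> Arr Q (fst z) q"
      using zo q rc by (rule Inf_closed)
    fix u assume u: "u \<in> Arr Q (fst z) q"
    have "u \<sqsubseteq>\<^bsub>Hom Q (fst z) q\<^esub> qhom ?A z a \<longleftrightarrow>
      (\<forall>y \<in> Y. Comp Q (fst z) q (t y) (snd a y) u \<sqsubseteq>\<^bsub>Hom Q (fst z) (t y)\<^esub> snd z y)"
      using copresheaves_hom_iff[OF _ zP aP, of u] u t by (simp add: A_hom fa)
    also have "\<dots> \<longleftrightarrow> (\<forall>y \<in> Y. \<forall>x \<in> Obj ?A.
      Comp Q (fst z) (fst x) (t y) (snd x y) (Comp Q (fst z) q (fst x) (l x) u)
        \<sqsubseteq>\<^bsub>Hom Q (fst z) (t y)\<^esub> snd z y)"
    proof (rule ball_cong[OF refl])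
      fix y assume y: "y \<in> Y"
      have "Comp Q (fst z) q (t y) (snd a y) u =
        \<Squnion>\<^bsub>Hom Q (fst z) (t y)\<^esub> ((\<lambda>v. Comp Q (fst z) q (t y) v u) ` f y ` Obj ?A)"
        unfolding sa[OF y] using f[OF y] by (intro Comp_Sup_left zo q t[OF y] u) auto
      moreover have "(\<lambda>x. Comp Q (fst z) q (t y) (f y x) u) \<in> Obj ?A \<rightarrow> Arr Q (fst z) (t y)"
        using f[OF y] zo q t[OF y] u by (auto intro: Comp_closed)
      ultimately have "Comp Q (fst z) q (t y) (snd a y) u \<sqsubseteq>\<^bsub>Hom Q (fst z) (t y)\<^esub> snd z y \<longleftrightarrow>
        (\<forall>x \<in> Obj ?A. Comp Q (fst z) q (t y) (f y x) u \<sqsubseteq>\<^bsub>Hom Q (fst z) (t y)\<^esub> snd z y)"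
        unfolding image_image by (simp add: Sup_iff[OF zo t[OF y] _ P(2)[OF zP y]])
      also have "\<dots> \<longleftrightarrow> (\<forall>x \<in> Obj ?A.
        Comp Q (fst z) (fst x) (t y) (snd x y) (Comp Q (fst z) q (fst x) (l x) u)
        \<sqsubseteq>\<^bsub>Hom Q (fst z) (t y)\<^esub> snd z y)"
        unfolding f_def using Comp_assoc[OF zo q P(1)[OF AP] t[OF y] u l P(2)[OF AP y]] by simp
      finally show "Comp Q (fst z) q (t y) (snd a y) u \<sqsubseteq>\<^bsub>Hom Q (fst z) (t y)\<^esub> snd z y \<longleftrightarrow> \<dots>" .
    qed
    also have "\<dots> \<longleftrightarrow> (\<forall>x \<in> Obj ?A. Comp Q (fst z) q (fst x) (l x) u
        \<sqsubseteq>\<^bsub>Hom Q (fst z) (fst x)\<^esub> qhom ?A z x)"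
    proof -
      have "Comp Q (fst z) q (fst x) (l x) u \<sqsubseteq>\<^bsub>Hom Q (fst z) (fst x)\<^esub> qhom ?A z x \<longleftrightarrow>
        (\<forall>y \<in> Y. Comp Q (fst z) (fst x) (t y) (snd x y) (Comp Q (fst z) q (fst x) (l x) u)
        \<sqsubseteq>\<^bsub>Hom Q (fst z) (t y)\<^esub> snd z y)" if x: "x \<in> Obj ?A" for x
        unfolding A_hom
        by (rule copresheaves_hom_iff[OF _ zP AP[OF x]])
           (use t Comp_closed[OF zo q P(1)[OF AP[OF x]] u l[OF x]] in auto)
      then show ?thesis by blast
    qed
    also have "\<dots> \<longleftrightarrow> (\<forall>x \<in> Obj ?A. u \<sqsubseteq>\<^bsub>Hom Q (fst z) q\<^esub> rimp Q (fst z) q (fst x) (l x) (qhom ?A z x))"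
      using rimp_iff[OF zo q P(1)[OF AP] l hz u] by simp
    also have "\<dots> \<longleftrightarrow> u \<sqsubseteq>\<^bsub>Hom Q (fst z) q\<^esub>
      \<Sqinter>\<^bsub>Hom Q (fst z) q\<^esub> ((\<lambda>x. rimp Q (fst z) q (fst x) (l x) (qhom ?A z x)) ` Obj ?A)"
      using Inf_iff[OF zo q rc u] by simp
    finally show "u \<sqsubseteq>\<^bsub>Hom Q (fst z) q\<^esub> qhom ?A z a \<longleftrightarrow> \<dots>" .
  qed
  with aA show "\<exists>a\<in>Obj ?A. otype ?A a = q \<and> (\<forall>z\<in>Obj ?A. qhom ?A z a =
    \<Sqinter>\<^bsub>Hom Q (otype ?A z) q\<^esub> ((\<lambda>x. rimp Q (otype ?A z) q (otype ?A x) (l x) (qhom ?A z x)) ` Obj ?A))"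
    unfolding A_typ using fa by blast
qed

end


section \<open>The quantaloid of a frame is a quantaloid\<close>

lemma range_complete_lattice:
  fixes c :: "'a::complete_lattice \<Rightarrow> 'b"
  assumes c: "\<And>a b. lq (c a) (c b) \<longleftrightarrow> a \<le> b"
  defines "L \<equiv> \<lparr>carrier = range c, eq = (=), le = lq\<rparr>"
  shows "complete_lattice L" and "\<Squnion>\<^bsub>L\<^esub> (c ` S) = c (Sup S)"
proof -
  have inj: "c a = c b \<longleftrightarrow> a = b" for a b using c by (metis order.antisym order.refl)
  have po: "partial_order L"
    unfolding L_def by unfold_locales (auto simp: c inj intro: order.trans)
  interpret partial_order L by (rule po)
  have lub: "least L (c (Sup A)) (Upper L (c ` A))" for A
    by (rule least_UpperI) (auto simp: L_def Upper_def c inj intro!: Sup_upper Sup_least[of A], use c in blast)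
  have glb: "greatest L (c (Inf A)) (Lower L (c ` A))" for A
    by (rule greatest_LowerI) (auto simp: L_def Lower_def c inj intro!: Inf_lower Inf_greatest[of A], use c in blast)
  have carr: "A \<subseteq> carrier L \<Longrightarrow> \<exists>B. A = c ` B" for A unfolding L_def by (simp add: subset_image_iff)
  show "complete_lattice L"
  proof (rule complete_latticeI)
    fix A assume "A \<subseteq> carrier L"
    then obtain B where "A = c ` B" using carr by blast
    then show "\<exists>s. least L s (Upper L A)" "\<exists>i. greatest L i (Lower L A)" using lub glb by blast+
  qed
  then interpret complete_lattice L .
  show "\<Squnion>\<^bsub>L\<^esub> (c ` S) = c (Sup S)"
    by (rule least_unique[OF weak.sup_lub lub]) (auto simp: L_def)
qed

lemma QO_hom_endo: "QO_hom p p = \<lparr>carrier = range (\<lambda>b. if b then One else Zero), eq = (=), le = arrow_le\<rparr>"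
  and QO_hom_L1: "QO_hom (-1) 0 = \<lparr>carrier = range InL1, eq = (=), le = arrow_le\<rparr>"
  and QO_hom_P: "q \<ge> 1 \<Longrightarrow> QO_hom 0 q = \<lparr>carrier = range InP, eq = (=), le = arrow_le\<rparr>"
  and QO_hom_L2: "q \<ge> 1 \<Longrightarrow> QO_hom (-1) q = \<lparr>carrier = range InL2, eq = (=), le = arrow_le\<rparr>"
  by (auto simp: QO_hom_def split: if_splits)

lemma QO_hom_cases:
  fixes p q :: int
  obtains (endo) "p = q" | (L1) "p = -1" "q = 0" | (P) "p = 0" "q \<ge> 1" | (L2) "p = -1" "q \<ge> 1"
  | (trivial) "p \<noteq> q" "\<not> (p = -1 \<and> q = 0)" "\<not> (p = 0 \<and> q \<ge> 1)" "\<not> (p = -1 \<and> q \<ge> 1)"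
  by blast

lemma QO_hom_trivial:
  "\<lbrakk>p \<noteq> q; \<not> (p = -1 \<and> q = 0); \<not> (p = 0 \<and> q \<ge> 1); \<not> (p = -1 \<and> q \<ge> 1)\<rbrakk>
   \<Longrightarrow> QO_hom p q = \<lparr>carrier = range (\<lambda>_::unit. Zero), eq = (=), le = arrow_le\<rparr>"
  by (auto simp: QO_hom_def)

lemma QO_hom_complete:
  "complete_lattice (QO_hom p q :: ('l1::complete_lattice, 'l2::complete_lattice, 'p::complete_lattice) arrow gorder)"
proof (cases p q rule: QO_hom_cases)
  case endo
  then show ?thesis by (simp only: QO_hom_endo) (rule range_complete_lattice, auto)
next
  case L1 then show ?thesis by (simp only: QO_hom_L1) (rule range_complete_lattice, auto)
next
  case P then show ?thesis by (simp only: QO_hom_P) (rule range_complete_lattice, auto)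
next
  case L2 then show ?thesis by (simp only: QO_hom_L2) (rule range_complete_lattice, auto)
next
  case trivial show ?thesis by (subst QO_hom_trivial[OF trivial]) (rule range_complete_lattice, auto)
qed

lemma QO_Sup_L1: "\<Squnion>\<^bsub>QO_hom (-1) 0\<^esub> (InL1 ` S) = InL1 (Sup S)" for S :: "'a::complete_lattice set"
  by (simp only: QO_hom_L1) (rule range_complete_lattice, simp)

lemma QO_Sup_P: "r \<ge> 1 \<Longrightarrow> \<Squnion>\<^bsub>QO_hom 0 r\<^esub> (InP ` S) = InP (Sup S)" for S :: "'a::complete_lattice set"
  by (simp only: QO_hom_P) (rule range_complete_lattice, simp)

lemma QO_Sup_L2: "r \<ge> 1 \<Longrightarrow> \<Squnion>\<^bsub>QO_hom (-1) r\<^esub> (InL2 ` S) = InL2 (Sup S)" for S :: "'a::complete_lattice set"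
  by (simp only: QO_hom_L2) (rule range_complete_lattice, simp)

context multi_adjoint_oo_frame
begin


lemma amp_Sup_left:
  assumes "i \<in> {1..int n}"
  shows "amp i (Sup S) z = (SUP x\<in>S. amp i x z)"
proof -
  have "amp i (Sup S) z \<le> y \<longleftrightarrow> (SUP x\<in>S. amp i x z) \<le> y" for y
    by (simp add: amp_swa[OF assms] Sup_le_iff SUP_le_iff)
  then show ?thesis by (meson order.antisym order.refl)
qed

lemma amp_Sup_right:
  assumes "i \<in> {1..int n}"
  shows "amp i x (Sup S) = (SUP z\<in>S. amp i x z)"
proof -
  have "amp i x (Sup S) \<le> y \<longleftrightarrow> (SUP z\<in>S. amp i x z) \<le> y" for y
    by (simp add: amp_nwa[OF assms] Sup_le_iff SUP_le_iff)
  then show ?thesis by (meson order.antisym order.refl)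
qed

abbreviation "bt p q \<equiv> \<bottom>\<^bsub>QO_hom p q\<^esub>"

lemma bt_eq: "(bt p q :: ('l1, 'l2, 'p) arrow) = \<Squnion>\<^bsub>QO_hom p q\<^esub> {}"
proof -
  interpret complete_lattice "QO_hom p q :: ('l1, 'l2, 'p) arrow gorder" by (rule QO_hom_complete)
  show ?thesis using weak.weak_sup_empty eq_is_equal by metis
qed

lemma bt_closed: "(bt p q :: ('l1, 'l2, 'p) arrow) \<in> carrier (QO_hom p q)"
proof -
  interpret complete_lattice "QO_hom p q :: ('l1, 'l2, 'p) arrow gorder" by (rule QO_hom_complete)
  show ?thesis by simp
qed

lemma Sup_bt:
  assumes "S \<subseteq> {bt p q}"
  shows "(\<Squnion>\<^bsub>QO_hom p q\<^esub> S :: ('l1, 'l2, 'p) arrow) = bt p q"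
proof -
  interpret complete_lattice "QO_hom p q :: ('l1, 'l2, 'p) arrow gorder" by (rule QO_hom_complete)
  have "S = {} \<or> S = {bt p q}" using assms by blast
  then show ?thesis using bt_closed bt_eq by (auto simp: sup_of_singleton)
qed

lemma Sup_bt_insert:
  assumes "v \<in> carrier (QO_hom p q)" "v \<in> S" "S \<subseteq> {bt p q, v}"
  shows "(\<Squnion>\<^bsub>QO_hom p q\<^esub> S :: ('l1, 'l2, 'p) arrow) = v"
proof -
  interpret complete_lattice "QO_hom p q :: ('l1, 'l2, 'p) arrow gorder" by (rule QO_hom_complete)
  have S: "S \<subseteq> carrier (QO_hom p q)" using assms bt_closed by blast
  show ?thesis
    by (rule le_antisym) (use assms S in \<open>auto intro!: weak.sup_least weak.sup_upper\<close>)
qed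

lemma bt_endo: "(bt p p :: ('l1, 'l2, 'p) arrow) = Zero"
proof -
  have "\<Squnion>\<^bsub>QO_hom p p\<^esub> ((\<lambda>b. if b then One else Zero :: ('l1, 'l2, 'p) arrow) ` {}) = Zero"
    unfolding QO_hom_endo by (subst range_complete_lattice(2)) auto
  then show ?thesis by (simp add: bt_eq)
qed

lemma arr_endo: "carrier (QO_hom p p) = {Zero, One}"
  by (simp add: QO_hom_def)

lemma bt_trivial: "carrier (QO_hom p q :: ('l1, 'l2, 'p) arrow gorder) = {Zero} \<Longrightarrow>
    (bt p q :: ('l1, 'l2, 'p) arrow) = Zero"
  using bt_closed by auto

lemma comp_bt:
  assumes "u \<in> carrier (QO_hom p q)" "v \<in> carrier (QO_hom q r)" "u \<noteq> One" "v \<noteq> One"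
    "\<not> (p = -1 \<and> q = 0 \<and> r \<ge> 1)"
  shows "QO_comp amp p q r v u = bt p r"
  using assms by (cases v; cases u) (auto simp: QO_hom_def split: if_splits)

lemma One_arr: "One \<in> carrier (QO_hom p q :: ('l1, 'l2, 'p) arrow gorder) \<longleftrightarrow> p = q"
  by (auto simp: QO_hom_def)

lemma comp_One [simp]: "QO_comp amp p q r u One = u"
  by (cases u) auto

lemma comp_Sup_right:
  fixes v :: "('l1, 'l2, 'p) arrow"
  assumes "r \<le> int n" "S \<subseteq> carrier (QO_hom p q)" "v \<in> carrier (QO_hom q r)"
  shows "QO_comp amp p q r v (\<Squnion>\<^bsub>QO_hom p q\<^esub> S) = \<Squnion>\<^bsub>QO_hom p r\<^esub> ((\<lambda>u. QO_comp amp p q r v u) ` S)"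
proof -
  interpret pq: complete_lattice "QO_hom p q :: ('l1, 'l2, 'p) arrow gorder" by (rule QO_hom_complete)
  consider "v = One" | "v \<noteq> One" "p = q" | "v \<noteq> One" "p = -1" "q = 0" "r \<ge> 1"
    | "v \<noteq> One" "p \<noteq> q" "\<not> (p = -1 \<and> q = 0 \<and> r \<ge> 1)" by blast
  then show ?thesis
  proof cases
    case 1
    then show ?thesis using assms by (simp add: One_arr)
  next
    case 2
    have Z: "QO_comp amp p q r v Zero = bt p r"
      using 2 by (cases v) auto
    show ?thesis
    proof (cases "One \<in> S")
      case True
      then have "\<Squnion>\<^bsub>QO_hom p q\<^esub> S = One"
        using assms 2 by (intro Sup_bt_insert) (auto simp: bt_endo arr_endo)
      moreover have "\<Squnion>\<^bsub>QO_hom p r\<^esub> ((\<lambda>u. QO_comp amp p q r v u) ` S) = v"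
        using assms 2 True Z by (intro Sup_bt_insert) (auto simp: arr_endo image_iff intro: bexI[of _ One])
      ultimately show ?thesis by simp
    next
      case False
      then have S: "S \<subseteq> {Zero}" using assms 2 by (auto simp: QO_hom_def)
      then have "\<Squnion>\<^bsub>QO_hom p q\<^esub> S = Zero"
        using 2 Sup_bt[of S p q] by (auto simp: bt_endo)
      moreover have "\<Squnion>\<^bsub>QO_hom p r\<^esub> ((\<lambda>u. QO_comp amp p q r v u) ` S) = bt p r"
        using S Z by (intro Sup_bt) auto
      ultimately show ?thesis using Z by simp
    qed
  next
    case 3
    obtain z where z: "v = InP z" using 3 assms by (auto simp: QO_hom_def)
    obtain T where T: "S = InL1 ` T" using 3 assms by (auto simp: QO_hom_def subset_image_iff)
    have "QO_comp amp p q r v ` S = InL2 ` (\<lambda>x. amp r x z) ` T"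
      by (auto simp: z T image_image)
    then show ?thesis using 3 assms(1)
      by (simp only: T QO_Sup_L1 QO_Sup_L2 z QO_comp.simps amp_Sup_left atLeastAtMost_iff)
  next
    case 4
    have Sup: "\<Squnion>\<^bsub>QO_hom p q\<^esub> S \<in> carrier (QO_hom p q)" using assms by simp
    have *: "QO_comp amp p q r v u = bt p r" if "u = \<Squnion>\<^bsub>QO_hom p q\<^esub> S \<or> u \<in> S" for u
    proof -
      have "u \<in> carrier (QO_hom p q)" using that Sup assms by blast
      moreover from this have "u \<noteq> One" using 4 One_arr by blast
      ultimately show ?thesis using 4 assms by (intro comp_bt) auto
    qed
    show ?thesis using * by (subst Sup_bt) auto
  qed
qed

lemma comp_Sup_left:
  fixes u :: "('l1, 'l2, 'p) arrow"
  assumes "r \<le> int n" "u \<in> carrier (QO_hom p q)" "S \<subseteq> carrier (QO_hom q r)"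
  shows "QO_comp amp p q r (\<Squnion>\<^bsub>QO_hom q r\<^esub> S) u = \<Squnion>\<^bsub>QO_hom p r\<^esub> ((\<lambda>v. QO_comp amp p q r v u) ` S)"
proof -
  interpret qr: complete_lattice "QO_hom q r :: ('l1, 'l2, 'p) arrow gorder" by (rule QO_hom_complete)
  consider "u = One" | "u \<noteq> One" "q = r" | "u \<noteq> One" "p = -1" "q = 0" "r \<ge> 1"
    | "u \<noteq> One" "q \<noteq> r" "\<not> (p = -1 \<and> q = 0 \<and> r \<ge> 1)" by blast
  then show ?thesis
  proof cases
    case 1
    then show ?thesis using assms by (simp add: One_arr)
  next
    case 2
    have Z: "QO_comp amp p q r Zero u = bt p r"
      using 2 by (cases u) auto
    show ?thesis
    proof (cases "One \<in> S")
      case True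
      then have "\<Squnion>\<^bsub>QO_hom q r\<^esub> S = One"
        using assms 2 by (intro Sup_bt_insert) (auto simp: bt_endo arr_endo)
      moreover have "\<Squnion>\<^bsub>QO_hom p r\<^esub> ((\<lambda>v. QO_comp amp p q r v u) ` S) = u"
        using assms 2 True Z by (intro Sup_bt_insert) (auto simp: arr_endo image_iff intro: bexI[of _ One])
      ultimately show ?thesis by simp
    next
      case False
      then have S: "S \<subseteq> {Zero}" using assms 2 by (auto simp: QO_hom_def)
      then have "\<Squnion>\<^bsub>QO_hom q r\<^esub> S = Zero"
        using 2 Sup_bt[of S q r] by (auto simp: bt_endo)
      moreover have "\<Squnion>\<^bsub>QO_hom p r\<^esub> ((\<lambda>v. QO_comp amp p q r v u) ` S) = bt p r"
        using S Z by (intro Sup_bt) auto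
      ultimately show ?thesis using Z by simp
    qed
  next
    case 3
    obtain x where x: "u = InL1 x" using 3 assms by (auto simp: QO_hom_def)
    obtain T where T: "S = InP ` T" using 3 assms by (auto simp: QO_hom_def subset_image_iff)
    have "(\<lambda>v. QO_comp amp p q r v u) ` S = InL2 ` amp r x ` T"
      by (auto simp: x T image_image)
    then show ?thesis using 3 assms(1)
      by (simp only: T QO_Sup_P QO_Sup_L2 x QO_comp.simps amp_Sup_right atLeastAtMost_iff)
  next
    case 4
    have Sup: "\<Squnion>\<^bsub>QO_hom q r\<^esub> S \<in> carrier (QO_hom q r)" using assms by simp
    have *: "QO_comp amp p q r v u = bt p r" if "v = \<Squnion>\<^bsub>QO_hom q r\<^esub> S \<or> v \<in> S" for v
    proof -
      have "v \<in> carrier (QO_hom q r)" using that Sup assms by blast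
      moreover from this have "v \<noteq> One" using 4 One_arr by blast
      ultimately show ?thesis using 4 assms by (intro comp_bt) auto
    qed
    show ?thesis using * by (subst Sup_bt) auto
  qed
qed

lemma comp_bt_right: "\<lbrakk>r \<le> int n; v \<in> carrier (QO_hom q r)\<rbrakk> \<Longrightarrow> QO_comp amp p q r v (bt p q) = bt p r"
  using comp_Sup_right[of r "{}" p q v] by (simp add: bt_eq)

lemma comp_bt_left: "\<lbrakk>r \<le> int n; u \<in> carrier (QO_hom p q)\<rbrakk> \<Longrightarrow> QO_comp amp p q r (bt q r) u = bt p r"
  using comp_Sup_left[of r u p q "{}"] by (simp add: bt_eq)

lemma comp_closed:
  assumes "u \<in> carrier (QO_hom p q)" "v \<in> carrier (QO_hom q r)"
  shows "QO_comp amp p q r v u \<in> carrier (QO_hom p r)"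
proof -
  consider "u = One" | "v = One" | "u \<noteq> One" "v \<noteq> One" "p = -1" "q = 0" "r \<ge> 1"
    | "u \<noteq> One" "v \<noteq> One" "\<not> (p = -1 \<and> q = 0 \<and> r \<ge> 1)" by blast
  then show ?thesis
  proof cases
    case 4 then show ?thesis using comp_bt[OF assms] bt_closed by simp
  qed (use assms in \<open>auto simp: One_arr, auto simp: QO_hom_def\<close>)
qed

lemma comp_assoc:
  assumes r: "r \<le> int n" and s: "s \<le> int n"
    and u: "u \<in> carrier (QO_hom p q)" and v: "v \<in> carrier (QO_hom q r)" and w: "w \<in> carrier (QO_hom r s)"
  shows "QO_comp amp p q s (QO_comp amp q r s w v) u = QO_comp amp p r s w (QO_comp amp p q r v u)"
proof -
  consider "u = One" | "v = One" | "w = One" | "u \<noteq> One" "v \<noteq> One" "w \<noteq> One" by blast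
  then show ?thesis
  proof cases
    case 4
    consider "p = -1" "q = 0" "r \<ge> 1" | "q = -1" "r = 0" "s \<ge> 1"
      | "\<not> (p = -1 \<and> q = 0 \<and> r \<ge> 1)" "\<not> (q = -1 \<and> r = 0 \<and> s \<ge> 1)" by blast
    then show ?thesis
    proof cases
      case 1
      then have "w = Zero" using w 4 by (auto simp: QO_hom_def split: if_splits)
      moreover have "(bt r s :: ('l1, 'l2, 'p) arrow) = Zero"
        using 1 by (cases "r = s") (simp add: bt_endo, intro bt_trivial, auto simp: QO_hom_def)
      ultimately show ?thesis using comp_bt_left[OF s] u v comp_closed[OF u v] by metis
    next
      case 2
      then have "u = Zero" using u 4 by (auto simp: QO_hom_def split: if_splits)
      moreover have "(bt p q :: ('l1, 'l2, 'p) arrow) = Zero"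
        using 2 u by (cases "p = q") (simp add: bt_endo, intro bt_trivial, auto simp: QO_hom_def split: if_splits)
      ultimately show ?thesis using comp_bt_right s r w v comp_closed[OF v w] by metis
    next
      case 3
      then show ?thesis using 4 comp_bt[OF u v] comp_bt[OF v w] comp_bt_left[OF s u] comp_bt_right[OF s w]
        by simp
    qed
  qed (use u v w in \<open>auto simp: One_arr\<close>)
qed

lemma quantaloid_QO: "quantaloid (QO n amp)"
  by (rule quantaloid.intro) (auto simp: QO_def One_arr QO_hom_complete comp_closed comp_assoc comp_Sup_right comp_Sup_left)

end

lemma (in multi_adjoint_oo_frame) rimp_QO:
  assumes "i \<in> {1..int n}"
  shows "rimp (QO n amp) (-1) 0 i (InP z) (InL2 y) = InL1 (swa i y z)"
  unfolding rimp_def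
  by (rule the_equality) (use assms in \<open>auto simp: QO_def QO_hom_L1 QO_hom_L2 amp_swa, metis order.antisym order.refl\<close>)

lemma qrelation_phi_O:
  assumes "t \<in> Y \<rightarrow> {1..int n}"
  shows "qrelation (QO n amp) (phi_O X Y \<phi> t)"
proof -
  have "1 \<le> t y \<and> t y \<le> int n" if "y \<in> Y" for y using assms that by auto
  moreover from this have "-1 \<le> t y" if "y \<in> Y" for y using that by fastforce
  ultimately show ?thesis by (auto simp: qrelation_def phi_O_def QO_def QO_hom_P)
qed

corollary (in multi_adjoint_oo_frame) K_dagger_phi_O_complete:
  assumes "t \<in> Y \<rightarrow> {1..int n}"
  shows "complete_qcategory (QO n amp) (K_dagger (QO n amp) (phi_O X Y \<phi> t))"
  using quantaloid.K_dagger_complete quantaloid_QO qrelation_phi_O assms by blast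

end

theory Submission
  imports Defs
begin

text \<open>On copresheaves of type \<open>-1\<close> over \<open>Y\<close>, the right implications and composites in the dual
  Kan adjunction of \<open>\<phi>\<^sub>O\<close> only involve the hom-sets \<open>L\<^sub>1\<close>, \<open>P\<close>, \<open>L\<^sub>2\<close>, where they are \<open>\<swarrow>\<^sup>i\<close> and \<open>&\<^sub>i\<close>.
  So both Galois connections agree up to the tagging \<open>InL2\<close>, and a concept \<open>(\<lambda>, \<mu>)\<close> is determined
  by its fixed point \<open>\<lambda>\<close>. Fixed points are closed under pointwise suprema because \<open>&\<^sub>i\<close> preserves
  suprema; these are the infima of the reverse pointwise order, so the concepts form a complete
  lattice, and the order isomorphism carries this structure over to the fibre.\<close>

section \<open>Transport of a complete lattice structure along an order isomorphism\<close>

lemma complete_lattice_isoI: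
  assumes L: "complete_lattice L" and M: "eq M = (=)"
    and bij: "bij_betw h (carrier L) (carrier M)"
    and ord: "\<And>x y. \<lbrakk>x \<in> carrier L; y \<in> carrier L\<rbrakk> \<Longrightarrow> h x \<sqsubseteq>\<^bsub>M\<^esub> h y \<longleftrightarrow> x \<sqsubseteq>\<^bsub>L\<^esub> y"
  shows "complete_lattice_iso L M h"
proof -
  interpret L: complete_lattice L by (rule L)
  have carrM: "carrier M = h ` carrier L" using bij by (simp add: bij_betw_def)
  \<comment> \<open>Nothing is assumed about the order of \<open>M\<close>: every element of its
    carrier is some \<open>h x\<close>, so \<open>ord\<close> pulls each order axiom back to
    \<open>L\<close>.\<close>
  interpret M: partial_order M
  proof unfold_locales
    fix x y assume "x \<in> carrier M" "y \<in> carrier M" "x \<sqsubseteq>\<^bsub>M\<^esub> y" "y \<sqsubseteq>\<^bsub>M\<^esub> x"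
    then show "x .=\<^bsub>M\<^esub> y" unfolding carrM M using ord L.le_antisym by fastforce
  next
    fix x y z assume "x \<in> carrier M" "y \<in> carrier M" "z \<in> carrier M" "x \<sqsubseteq>\<^bsub>M\<^esub> y" "y \<sqsubseteq>\<^bsub>M\<^esub> z"
    then show "x \<sqsubseteq>\<^bsub>M\<^esub> z" unfolding carrM using ord L.le_trans by fastforce
  qed (auto simp: carrM M ord)
  \<comment> \<open>Bounds come before completeness: an upper bound in \<open>M\<close> has the form
    \<open>h v\<close>, and \<open>ord\<close> turns \<open>v\<close> into an upper bound of
    \<open>A\<close> in \<open>L\<close>. The bounds found here and in \<open>inf\<close> make
    \<open>M\<close> complete, and their uniqueness gives preservation of suprema and
    infima.\<close>
  have sup: "least M (h (\<Squnion>\<^bsub>L\<^esub> A)) (Upper M (h ` A))" if A: "A \<subseteq> carrier L" for A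
  proof (rule least_UpperI)
    show "x \<sqsubseteq>\<^bsub>M\<^esub> h (\<Squnion>\<^bsub>L\<^esub> A)" if x: "x \<in> h ` A" for x
    proof -
      obtain a where a: "a \<in> A" "x = h a" using x by blast
      then have "h a \<sqsubseteq>\<^bsub>M\<^esub> h (\<Squnion>\<^bsub>L\<^esub> A) \<longleftrightarrow> a \<sqsubseteq>\<^bsub>L\<^esub> \<Squnion>\<^bsub>L\<^esub> A"
        using A L.weak.sup_closed[OF A] by (intro ord) auto
      then show ?thesis using a L.weak.sup_upper[OF A] by simp
    qed
    show "h (\<Squnion>\<^bsub>L\<^esub> A) \<sqsubseteq>\<^bsub>M\<^esub> u" if u: "u \<in> Upper M (h ` A)" for u
    proof -
      obtain v where v: "v \<in> carrier L" "u = h v" using u carrM by (auto simp: Upper_def)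
      have "a \<sqsubseteq>\<^bsub>L\<^esub> v" if a: "a \<in> A" for a
      proof -
        have "a \<in> carrier L" using a A by blast
        then show ?thesis using u v a ord[of a v] carrM by (simp add: Upper_def)
      qed
      then show ?thesis using v A ord[OF L.weak.sup_closed[OF A] v(1)] by (simp add: L.weak.sup_least)
    qed
  qed (use A carrM in auto)
  have inf: "greatest M (h (\<Sqinter>\<^bsub>L\<^esub> A)) (Lower M (h ` A))" if A: "A \<subseteq> carrier L" for A
  proof (rule greatest_LowerI)
    show "h (\<Sqinter>\<^bsub>L\<^esub> A) \<sqsubseteq>\<^bsub>M\<^esub> x" if x: "x \<in> h ` A" for x
    proof -
      obtain a where a: "a \<in> A" "x = h a" using x by blast
      then have "h (\<Sqinter>\<^bsub>L\<^esub> A) \<sqsubseteq>\<^bsub>M\<^esub> h a \<longleftrightarrow> \<Sqinter>\<^bsub>L\<^esub> A \<sqsubseteq>\<^bsub>L\<^esub> a"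
        using A L.weak.inf_closed[OF A] by (intro ord) auto
      then show ?thesis using a L.weak.inf_lower[OF A] by simp
    qed
    show "u \<sqsubseteq>\<^bsub>M\<^esub> h (\<Sqinter>\<^bsub>L\<^esub> A)" if u: "u \<in> Lower M (h ` A)" for u
    proof -
      obtain v where v: "v \<in> carrier L" "u = h v" using u carrM by (auto simp: Lower_def)
      have "v \<sqsubseteq>\<^bsub>L\<^esub> a" if a: "a \<in> A" for a
      proof -
        have "a \<in> carrier L" using a A by blast
        then show ?thesis using u v a ord[of v a] carrM by (simp add: Lower_def)
      qed
      then show ?thesis using v A ord[OF v(1) L.weak.inf_closed[OF A]] by (simp add: L.weak.inf_greatest)
    qed
  qed (use A carrM in auto)
  have carr: "\<exists>B \<subseteq> carrier L. A = h ` B" if "A \<subseteq> carrier M" for A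
    using that by (simp add: carrM subset_image_iff)
  interpret M: complete_lattice M
    by (rule M.complete_latticeI; drule carr) (use sup inf in blast)+
  have "h (\<Squnion>\<^bsub>L\<^esub> A) = \<Squnion>\<^bsub>M\<^esub> (h ` A)" "h (\<Sqinter>\<^bsub>L\<^esub> A) = \<Sqinter>\<^bsub>M\<^esub> (h ` A)" if A: "A \<subseteq> carrier L" for A
  proof -
    have "h ` A \<subseteq> carrier M" using A carrM by blast
    then show "h (\<Squnion>\<^bsub>L\<^esub> A) = \<Squnion>\<^bsub>M\<^esub> (h ` A)" "h (\<Sqinter>\<^bsub>L\<^esub> A) = \<Sqinter>\<^bsub>M\<^esub> (h ` A)"
      using M.least_unique[OF sup[OF A] M.weak.sup_lub] M.greatest_unique[OF inf[OF A] M.weak.inf_glb]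
      by auto
  qed
  then show ?thesis
    using L M.complete_lattice_axioms bij ord
    by (auto simp: complete_lattice_iso_def sup_pres_def inf_pres_def)
qed

text \<open>For \<open>kan_lower\<close> at type -1, whose infima over properties of type 0 are
  taken in this hom-set.\<close>

lemma QO_Inf_L1:
  "\<Sqinter>\<^bsub>QO_hom (-1) 0\<^esub> (InL1 ` S) =
    (InL1 (Inf S) :: ('l1::complete_lattice, 'l2::complete_lattice, 'p::complete_lattice) arrow)"
proof -
  let ?H = "QO_hom (-1) 0 :: ('l1, 'l2, 'p) arrow gorder"
  interpret complete_lattice ?H by (rule QO_hom_complete)
  have S: "InL1 ` S \<subseteq> carrier ?H" by (auto simp: QO_hom_L1)
  have "greatest ?H (InL1 (Inf S)) (Lower ?H (InL1 ` S))"
  proof (rule greatest_LowerI)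
    fix u assume "u \<in> Lower ?H (InL1 ` S)"
    then obtain b where "u = InL1 b" "\<forall>a \<in> S. b \<le> a" by (fastforce simp: QO_hom_L1 Lower_def)
    then show "u \<sqsubseteq>\<^bsub>?H\<^esub> InL1 (Inf S)" by (auto simp: QO_hom_L1 intro: Inf_greatest)
  qed (use S in \<open>auto simp: QO_hom_L1 intro: Inf_lower\<close>)
  then show ?thesis using greatest_unique[OF weak.inf_glb[OF S]] by blast
qed

section \<open>Completeness of the concept lattice\<close>

context multi_adjoint_oo_frame
begin

text \<open>Unfolding the supremum and the infimum leaves one inequality for each pair
  \<open>x\<close>, \<open>y\<close>, and \<open>amp_swa\<close> transposes each of them.\<close>

lemma oo_lower_upper_galois:
  assumes "t \<in> Y \<rightarrow> {1..int n}"
  shows "(\<forall>y \<in> Y. oo_upper amp X Y \<phi> t m y \<le> l y) \<longleftrightarrow> (\<forall>x \<in> X. m x \<le> oo_lower swa X Y \<phi> t l x)"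
proof -
  have "amp (t y) (m x) (\<phi> x y) \<le> l y \<longleftrightarrow> m x \<le> swa (t y) (l y) (\<phi> x y)" if "y \<in> Y" for x y
    using assms that by (intro amp_swa) auto
  then show ?thesis by (auto simp: oo_upper_def oo_lower_def SUP_le_iff le_INF_iff)
qed

lemma oo_lower_mono:
  assumes t: "t \<in> Y \<rightarrow> {1..int n}" and "\<And>y. y \<in> Y \<Longrightarrow> l y \<le> l' y" and "x \<in> X"
  shows "oo_lower swa X Y \<phi> t l x \<le> oo_lower swa X Y \<phi> t l' x"
proof -
  \<comment> \<open>The counit, as the transpose of reflexivity; weakening it to \<open>l'\<close>
    and transposing back gives monotonicity.\<close>
  have "\<forall>y \<in> Y. oo_upper amp X Y \<phi> t (oo_lower swa X Y \<phi> t l) y \<le> l y"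
    by (simp only: oo_lower_upper_galois[OF t]) simp
  then have "\<forall>y \<in> Y. oo_upper amp X Y \<phi> t (oo_lower swa X Y \<phi> t l) y \<le> l' y"
    using assms(2) order.trans by blast
  then show ?thesis using assms(3) by (simp add: oo_lower_upper_galois[OF t])
qed

lemma oo_upper_mono:
  assumes t: "t \<in> Y \<rightarrow> {1..int n}" and "\<And>x. x \<in> X \<Longrightarrow> m x \<le> m' x" and "y \<in> Y"
  shows "oo_upper amp X Y \<phi> t m y \<le> oo_upper amp X Y \<phi> t m' y"
proof -
  have "\<forall>x \<in> X. m' x \<le> oo_lower swa X Y \<phi> t (oo_upper amp X Y \<phi> t m') x"
    by (simp only: oo_lower_upper_galois[OF t, symmetric]) simp
  then have "\<forall>x \<in> X. m x \<le> oo_lower swa X Y \<phi> t (oo_upper amp X Y \<phi> t m') x"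
    using assms(2) order.trans by blast
  then show ?thesis using assms(3) by (simp add: oo_lower_upper_galois[OF t, symmetric])
qed

definition concepts where
  "concepts X Y \<phi> t = {l \<in> Y \<rightarrow>\<^sub>E UNIV. oo_upper amp X Y \<phi> t (oo_lower swa X Y \<phi> t l) = l}"

lemma carrier_oo_concept_lattice:
  "carrier (oo_concept_lattice amp swa X Y \<phi> t) =
     (\<lambda>l. (l, oo_lower swa X Y \<phi> t l)) ` concepts X Y \<phi> t"
  by (auto simp: oo_concept_lattice_def concepts_def oo_lower_def)

text \<open>\<open>?U\<close> after \<open>?L\<close> is monotone and, by the counit, deflationary
  in the pointwise order. Each fixed \<open>l\<close> below \<open>?s\<close> therefore stays below
  \<open>?U (?L ?s)\<close>.\<close>

lemma Sup_concepts:
  assumes t: "t \<in> Y \<rightarrow> {1..int n}" and S: "S \<subseteq> concepts X Y \<phi> t"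
  shows "(\<lambda>y \<in> Y. SUP l \<in> S. l y) \<in> concepts X Y \<phi> t"
proof -
  let ?U = "oo_upper amp X Y \<phi> t" and ?L = "oo_lower swa X Y \<phi> t"
  let ?s = "\<lambda>y \<in> Y. SUP l \<in> S. l y"
  have "?U (?L ?s) y = ?s y" if y: "y \<in> Y" for y
  proof (rule order.antisym)
    show "?U (?L ?s) y \<le> ?s y" using oo_lower_upper_galois[OF t] y by blast
    have "l y \<le> ?U (?L ?s) y" if l: "l \<in> S" for l
    proof -
      have "l y = ?U (?L l) y" using S l by (auto simp: concepts_def)
      also have "\<dots> \<le> ?U (?L ?s) y"
        by (intro oo_upper_mono[OF t _ y] oo_lower_mono[OF t]) (auto intro: SUP_upper2[OF l])
      finally show ?thesis .
    qed
    then show "?s y \<le> ?U (?L ?s) y" using y by (simp add: SUP_le_iff)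
  qed
  then have "?U (?L ?s) = ?s" by (intro extensionalityI[of _ Y]) (auto simp: oo_upper_def)
  then show ?thesis by (simp add: concepts_def)
qed

lemma complete_lattice_oo_concept_lattice:
  assumes t: "t \<in> Y \<rightarrow> {1..int n}"
  shows "complete_lattice (oo_concept_lattice amp swa X Y \<phi> t)" (is "complete_lattice ?C")
proof -
  let ?g = "\<lambda>l. (l, oo_lower swa X Y \<phi> t l)"
  have le: "c \<sqsubseteq>\<^bsub>?C\<^esub> d \<longleftrightarrow> (\<forall>y \<in> Y. fst d y \<le> fst c y)" for c d
    by (cases c; cases d) (simp add: oo_concept_lattice_def)
  have eq: "eq ?C = (=)" by (simp add: oo_concept_lattice_def)
  \<comment> \<open>The order compares values on \<open>Y\<close> only; extensionality settles the
    rest.\<close>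
  have antisym: "l = l'"
    if "l \<in> concepts X Y \<phi> t" "l' \<in> concepts X Y \<phi> t" "\<forall>y \<in> Y. l y \<le> l' y" "\<forall>y \<in> Y. l' y \<le> l y" for l l'
  proof (rule PiE_ext)
    show "l \<in> Y \<rightarrow>\<^sub>E UNIV" "l' \<in> Y \<rightarrow>\<^sub>E UNIV" using that by (simp_all add: concepts_def)
    show "l y = l' y" if "y \<in> Y" for y
      using that \<open>\<forall>y \<in> Y. l y \<le> l' y\<close> \<open>\<forall>y \<in> Y. l' y \<le> l y\<close> by (simp add: order.antisym)
  qed
  interpret partial_order ?C
  proof unfold_locales
    fix c d assume "c \<in> carrier ?C" "d \<in> carrier ?C" and cd: "c \<sqsubseteq>\<^bsub>?C\<^esub> d" "d \<sqsubseteq>\<^bsub>?C\<^esub> c"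
    then obtain l l' where l: "l \<in> concepts X Y \<phi> t" "l' \<in> concepts X Y \<phi> t" "c = ?g l" "d = ?g l'"
      by (auto simp: carrier_oo_concept_lattice)
    have "l = l'" using cd by (intro antisym l) (simp_all add: le l)
    then show "c .=\<^bsub>?C\<^esub> d" by (simp add: eq l)
  next
    fix b c d assume "b \<sqsubseteq>\<^bsub>?C\<^esub> c" "c \<sqsubseteq>\<^bsub>?C\<^esub> d"
    then show "b \<sqsubseteq>\<^bsub>?C\<^esub> d" unfolding le using order.trans by blast
  qed (simp_all add: eq le)
  have inf: "\<exists>i. greatest ?C i (Lower ?C A)" if A: "A \<subseteq> carrier ?C" for A
  proof -
    obtain S where S: "S \<subseteq> concepts X Y \<phi> t" "A = ?g ` S"
      using A by (auto simp: carrier_oo_concept_lattice subset_image_iff)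
    let ?s = "\<lambda>y \<in> Y. SUP l \<in> S. l y"
    have "greatest ?C (?g ?s) (Lower ?C A)"
    proof (rule greatest_LowerI)
      show "?g ?s \<in> carrier ?C"
        unfolding carrier_oo_concept_lattice using Sup_concepts[OF t S(1)] by (rule imageI)
    qed (use A S(2) in \<open>auto simp: le Lower_def intro!: SUP_upper SUP_least\<close>)
    then show ?thesis ..
  qed
  show ?thesis
  proof (rule complete_lattice_criterion1)
    \<comment> \<open>The criterion asks for a top element, which is the infimum of the empty set:
      its extent is the pointwise bottom on \<open>Y\<close>.\<close>
    have "greatest ?C i (carrier ?C)" if "greatest ?C i (Lower ?C {})" for i
      using that by (simp add: Lower_def)
    then show "\<exists>g. greatest ?C g (carrier ?C)" using inf[of "{}"] by blast
  qed (use inf in blast)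
qed

section \<open>Identification of the fibre at -1 with the tagged extents\<close>

definition tagged :: "'y set \<Rightarrow> ('y \<Rightarrow> 'l2) \<Rightarrow> int \<times> ('y \<Rightarrow> ('l1, 'l2, 'p) arrow)" where
  "tagged Y l = (-1, \<lambda>y \<in> Y. InL2 (l y))"

lemma kan_lower_phi_O:
  assumes t: "t \<in> Y \<rightarrow> {1..int n}"
  shows "kan_lower (QO n amp) (phi_O X Y \<phi> t) (tagged Y l) =
    (-1, \<lambda>x \<in> X. InL1 (oo_lower swa X Y \<phi> t l x))"
proof -
  \<comment> \<open>An image under \<open>InL1\<close> is the form to which \<open>QO_Inf_L1\<close>
    applies, also when \<open>Y\<close> is empty.\<close>
  have "(\<lambda>y. rimp (QO n amp) (-1) 0 (t y) (InP (\<phi> x y)) ((\<lambda>y \<in> Y. InL2 (l y)) y)) ` Y =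
      InL1 ` (\<lambda>y. swa (t y) (l y) (\<phi> x y)) ` Y" for x
    unfolding image_image using t by (intro image_cong refl) (auto simp: rimp_QO Pi_iff)
  then show ?thesis
    by (auto simp: kan_lower_def tagged_def phi_O_def QO_Inf_L1 oo_lower_def QO_def)
qed

lemma kan_upper_phi_O:
  assumes t: "t \<in> Y \<rightarrow> {1..int n}"
  shows "kan_upper (QO n amp) (phi_O X Y \<phi> t) (-1, \<lambda>x \<in> X. InL1 (m x)) =
    tagged Y (oo_upper amp X Y \<phi> t m)"
proof -
  have "(\<lambda>x. QO_comp amp (-1) 0 (t y) (InP (\<phi> x y)) ((\<lambda>x \<in> X. InL1 (m x)) x)) ` X =
      InL2 ` (\<lambda>x. amp (t y) (m x) (\<phi> x y)) ` X" for y
    unfolding image_image by (intro image_cong refl) auto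
  moreover have "1 \<le> t y" if "y \<in> Y" for y using t that by auto
  ultimately show ?thesis
    by (auto simp: kan_upper_def tagged_def phi_O_def QO_Sup_L2 oo_upper_def QO_def)
qed

lemma inj_on_tagged:
  fixes Y :: "'y set"
  shows "inj_on (tagged Y) (Y \<rightarrow>\<^sub>E UNIV)"
proof (rule inj_onI)
  fix l l' :: "'y \<Rightarrow> 'l2"
  assume l: "l \<in> Y \<rightarrow>\<^sub>E UNIV" "l' \<in> Y \<rightarrow>\<^sub>E UNIV" and eq: "tagged Y l = tagged Y l'"
  have "l y = l' y" if "y \<in> Y" for y
    using eq that by (auto simp: tagged_def dest!: fun_cong[of _ _ y])
  then show "l = l'" using l by (intro PiE_ext)
qed

text \<open>All types in \<open>Y\<close> are at least 1, so every value of \<open>k\<close> lies in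
  the range of \<open>InL2\<close> and can be untagged.\<close>

lemma tagged_surj:
  assumes t: "t \<in> Y \<rightarrow> {1..int n}" and k: "k \<in> (\<Pi>\<^sub>E y \<in> Y. Arr (QO n amp) (-1) (t y))"
  obtains l where "l \<in> Y \<rightarrow>\<^sub>E UNIV" "(-1, k) = tagged Y l"
proof
  let ?l = "\<lambda>y \<in> Y. THE a. k y = InL2 a"
  have "\<exists>a. k y = InL2 a" if "y \<in> Y" for y
  proof -
    have "1 \<le> t y" using t that by auto
    then show ?thesis using PiE_mem[OF k that] by (auto simp: QO_def QO_hom_L2)
  qed
  then have "k y = InL2 (?l y)" if "y \<in> Y" for y using that by fastforce
  moreover have "k \<in> extensional Y" using k by (simp add: PiE_def)
  ultimately show "(-1, k) = tagged Y ?l"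
    by (auto simp: tagged_def intro!: extensionalityI[of _ Y])
qed auto

lemma carrier_fibre_K_dagger_phi_O:
  assumes t: "t \<in> Y \<rightarrow> {1..int n}"
  shows "carrier (fibre (QO n amp) (K_dagger (QO n amp) (phi_O X Y \<phi> t)) (-1)) =
    tagged Y ` concepts X Y \<phi> t" (is "?F = _")
proof -
  let ?Q = "QO n amp"
  have F: "c \<in> ?F \<longleftrightarrow> fst c = -1 \<and> snd c \<in> (\<Pi>\<^sub>E y \<in> Y. Arr ?Q (-1) (t y)) \<and>
      kan_upper ?Q (phi_O X Y \<phi> t) (kan_lower ?Q (phi_O X Y \<phi> t) c) = c" for c
    by (auto simp: fibre_def K_dagger_def copresheaves_def phi_O_def QO_def)
  have mem: "snd (tagged Y l) \<in> (\<Pi>\<^sub>E y \<in> Y. Arr ?Q (-1) (t y))" for l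
  proof -
    have "1 \<le> t y" if "y \<in> Y" for y using t that by auto
    then show ?thesis by (auto simp: tagged_def QO_def QO_hom_L2)
  qed
  have tag: "tagged Y l \<in> ?F \<longleftrightarrow> l \<in> concepts X Y \<phi> t" if l: "l \<in> Y \<rightarrow>\<^sub>E UNIV" for l
  proof -
    \<comment> \<open>Tagging intertwines the two closure conditions; its injectivity on extensional
      maps then removes the tag.\<close>
    have "tagged Y l \<in> ?F \<longleftrightarrow> tagged Y (oo_upper amp X Y \<phi> t (oo_lower swa X Y \<phi> t l)) = tagged Y l"
      using mem by (simp add: F kan_lower_phi_O[OF t] kan_upper_phi_O[OF t]) (simp add: tagged_def)
    also have "\<dots> \<longleftrightarrow> l \<in> concepts X Y \<phi> t"
      using l by (subst inj_on_eq_iff[OF inj_on_tagged]) (auto simp: concepts_def oo_upper_def)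
    finally show ?thesis .
  qed
  show ?thesis
  proof (intro equalityI subsetI)
    fix c assume c: "c \<in> ?F"
    then obtain l where "l \<in> Y \<rightarrow>\<^sub>E UNIV" "c = tagged Y l"
      using tagged_surj[OF t, of "snd c"] F by (metis prod.collapse)
    then show "c \<in> tagged Y ` concepts X Y \<phi> t" using c tag by blast
  qed (use tag in \<open>auto simp: concepts_def\<close>)
qed

text \<open>The underlying order puts the identity below a meet of right implications. Transposing
  composes each \<open>InL2 (l' y)\<close> with \<open>One\<close>, which leaves it unchanged and
  below \<open>InL2 (l y)\<close>; hence the reversal.\<close>

lemma fibre_le_tagged:
  assumes t: "t \<in> Y \<rightarrow> {1..int n}"
  shows "tagged Y l \<sqsubseteq>\<^bsub>fibre (QO n amp) (K_dagger (QO n amp) (phi_O X Y \<phi> t)) (-1)\<^esub> tagged Y l' \<longleftrightarrow>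
    (\<forall>y \<in> Y. l' y \<le> l y)"
proof -
  let ?Q = "QO n amp" and ?P = "copresheaves (QO n amp) Y t"
  interpret quantaloid ?Q by (rule quantaloid_QO)
  have ty: "1 \<le> t y" "t y \<in> Ob ?Q" if "y \<in> Y" for y
    using funcset_mem[OF t that] by (auto simp: QO_def)
  have Obj: "tagged Y k \<in> Obj ?P" for k
    using ty by (auto simp: copresheaves_simps tagged_def) (auto simp: QO_def QO_hom_L2)
  have "One \<sqsubseteq>\<^bsub>Hom ?Q (-1) (-1)\<^esub> qhom ?P (tagged Y l) (tagged Y l') \<longleftrightarrow> (\<forall>y \<in> Y. l' y \<le> l y)"
    using copresheaves_hom_iff[OF ty(2) Obj Obj, of One l l'] ty(1)
    by (simp add: tagged_def) (simp add: QO_def One_arr QO_hom_L2)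
  then show ?thesis
    by (simp add: fibre_def K_dagger_def phi_O_def copresheaves_simps(2)) (simp add: tagged_def QO_def)
qed

end

theorem theorem5p7:
  fixes n :: nat
    and amp :: "int \<Rightarrow> 'l1::complete_lattice \<Rightarrow> 'p::complete_lattice \<Rightarrow> 'l2::complete_lattice"
    and swa :: "int \<Rightarrow> 'l2 \<Rightarrow> 'p \<Rightarrow> 'l1"
    and nwa :: "int \<Rightarrow> 'l2 \<Rightarrow> 'l1 \<Rightarrow> 'p"
    and X :: "'x set" and Y :: "'y set"
    and \<phi> :: "'x \<Rightarrow> 'y \<Rightarrow> 'p"
    and t :: "'y \<Rightarrow> int"
  assumes "multi_adjoint_oo_frame n amp swa nwa"
    and "t \<in> Y \<rightarrow> {1..int n}"
  shows "isomorphic_complete_lattices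
           (oo_concept_lattice amp swa X Y \<phi> t)
           (fibre (QO n amp) (K_dagger (QO n amp) (phi_O X Y \<phi> t)) (-1))"
proof -
  interpret multi_adjoint_oo_frame n amp swa nwa by fact
  note t = assms(2)
  let ?C = "oo_concept_lattice amp swa X Y \<phi> t"
    and ?F = "fibre (QO n amp) (K_dagger (QO n amp) (phi_O X Y \<phi> t)) (-1)"
  have "inj_on (tagged Y) (concepts X Y \<phi> t)"
    by (rule inj_on_subset[OF inj_on_tagged]) (auto simp: concepts_def)
  then have "bij_betw (\<lambda>c. tagged Y (fst c)) (carrier ?C) (carrier ?F)"
    by (auto simp: bij_betw_def inj_on_def carrier_oo_concept_lattice image_image
        carrier_fibre_K_dagger_phi_O[OF t])
  moreover have "tagged Y (fst c) \<sqsubseteq>\<^bsub>?F\<^esub> tagged Y (fst d) \<longleftrightarrow> c \<sqsubseteq>\<^bsub>?C\<^esub> d" for c d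
    by (cases c; cases d) (simp add: fibre_le_tagged[OF t] oo_concept_lattice_def)
  \<comment> \<open>The map drops the intent \<open>snd c\<close>, which the extent determines; the
    fibre inherits completeness from the concept lattice.\<close>
  ultimately have "complete_lattice_iso ?C ?F (\<lambda>c. tagged Y (fst c))"
    by (intro complete_lattice_isoI complete_lattice_oo_concept_lattice[OF t]) (auto simp: fibre_def)
  then show ?thesis unfolding isomorphic_complete_lattices_def by blast
qed

end
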